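(* Suppose that $\mathbb{P}$ is a product stationary probability on $\mathcal{A}^{\mathbb{N}}$, i.e. the coordinate projections from $\Omega$ to $\mathcal{A}$ are i.i.d. random variables. Let $\Gamma>0$ be a constant with $\mathbb{P}(B)\le e^{-\Gamma m}$ for all $m\ge1$ and $B\in\mathcal{C}_m$ (such a constant exists). Let $A=[a_0,\dots,a_{n-1}]\in\mathcal{C}_n$ with $\mathbb{P}(A)>0$, $t>0$, $N=[t(\mathbb{P}(A))^{-\ell}]$, $r=\pi(A)$, $\rho=\rho_A$, and assume $n>r(d_\ell+6)$. Let $W$ be a Poisson random variable with parameter $t(1-\rho)$ and let $\zeta_1,\zeta_2,\dots$ be i.i.d. random variables independent of $W$ having the geometric distribution with parameter $\rho$, i.e. $\mathbb{P}\{\zeta_1=k\}=(1-\rho)\rho^{k-1}$, $k=1,2,\dots$. Let $Y=\sum_{k=1}^W\zeta_k$. Then $$\sup_{L\subset\mathbb{N}}\big|\mathbb{P}\{S^A_N\in L\}-\mathbb{P}\{Y\in L\}\big|\le 2^{2\ell+8}(t+1)\ell^2d_\ell n^4e^{-\Gamma n/2}+2\wp\big(12d_\ell n^2(t+1)e^{-\Gamma n/2}\big)+\frac{t^{[n/r]+1}}{([n/r]+1)!}.$$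
   Context: $\mathbb{N}=\{0,1,2,\dots\}$; $[x]$ is the integral part of a number $x$; $\wp(x)=xe^x$. $\mathcal{A}$ is a finite or countable alphabet with more than one element, $\Omega=\mathcal{A}^{\mathbb{N}}$ with the $\sigma$-algebra generated by cylinder sets, $T$ is the left shift $(T\omega)_i=\omega_{i+1}$, and $\mathbb{P}$ is a $T$-invariant probability on $\Omega$ such that every cylinder $[a]=\{\omega:\omega_0=a\}$, $a\in\mathcal{A}$, has positive probability. $\mathcal{C}_n$ is the set of all $n$-cylinders $[a_0,\dots,a_{n-1}]=\{\omega\in\Omega:\omega_i=a_i,\ 0\le i\le n-1\}$. For $A\in\mathcal{C}_n$, $\pi(A)=\min\{k\in\{1,\dots,n\}:A\cap T^{-k}A\ne\emptyset\}$. Let $\ell\ge1$ and $q_i(k)=d_ik$, $i=1,\dots,\ell$, with integers $1\le d_1<d_2<\cdots<d_\ell$. For $A\in\mathcal{C}_n$: $X^A_k=\prod_{i=1}^\ell\mathbb{I}_A\circ T^{d_ik}$ and $S^A_N=\sum_{k=1}^NX^A_k$. For $R=[a_0,\dots,a_{r-1}]\in\mathcal{C}_r$ and an integer $n\ge r$, $$R^{n/r}=\Big(\bigcap_{k=0}^{[n/r]-1}T^{-kr}R\Big)\cap T^{-r[n/r]}\big([a_0,\dots,a_{n-r[n/r]-1}]\big),$$ where the last cylinder is $\Omega$ if $r$ divides $n$; thus $R^{n/r}$ is the $n$-cylinder obtained by repeating $a_0,\dots,a_{r-1}$ periodically. For $A=[a_0,\dots,a_{n-1}]\in\mathcal{C}_n$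 with $\mathbb{P}(A)>0$ put $r=\pi(A)$, $R=[a_0,\dots,a_{r-1}]$, $$\kappa=\mathrm{lcm}\Big\{\frac{r}{\gcd\{r,d_i\}}:1\le i\le\ell\Big\},\qquad \rho_A=\prod_{i=1}^\ell\mathbb{P}\big(R^{(n+d_i\kappa)/r}\,\big|\,A\big).$$ *)

theory Defs
  imports "HOL-Probability.Probability"
begin

definition shift :: "(nat \<Rightarrow> 'a) \<Rightarrow> nat \<Rightarrow> 'a" where
  "shift \<omega> = (\<lambda>i. \<omega> (Suc i))"

definition cylinder :: "'a list \<Rightarrow> (nat \<Rightarrow> 'a) set" where
  "cylinder a = {\<omega>. \<forall>i<length a. \<omega> i = a ! i}"

definition cylinders :: "nat \<Rightarrow> (nat \<Rightarrow> 'a) set set" where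
  "cylinders n = {cylinder a | a. length a = n}"

text \<open>The \<sigma>-algebra is the library's product of the discrete \<sigma>-algebras; the lemma
  \<open>sets_PiM_eq_sigma_cylinders\<close> below shows that the cylinder sets generate it.\<close>

locale shift_probability = prob_space P
  for P :: "(nat \<Rightarrow> 'a :: countable) measure" +
  assumes alphabet: "\<exists>a b :: 'a. a \<noteq> b"
    and sets_P: "sets P = sets (PiM UNIV (\<lambda>_. count_space UNIV))"
    and invariant: "distr P P shift = P"
    and cylinder_pos: "\<And>a. 0 < measure P (cylinder [a])"

definition product_stationary :: "(nat \<Rightarrow> 'a) measure \<Rightarrow> bool" where
  "product_stationary P \<longleftrightarrow>
     prob_space.indep_vars P (\<lambda>_. count_space UNIV) (\<lambda>i \<omega>. \<omega> i) UNIV \<and>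
     (\<forall>i. distr P (count_space UNIV) (\<lambda>\<omega>. \<omega> i) = distr P (count_space UNIV) (\<lambda>\<omega>. \<omega> 0))"

definition cylinder_decay :: "(nat \<Rightarrow> 'a) measure \<Rightarrow> real \<Rightarrow> bool" where
  "cylinder_decay P \<Gamma> \<longleftrightarrow>
     0 < \<Gamma> \<and> (\<forall>m\<ge>1. \<forall>B\<in>cylinders m. measure P B \<le> exp (- \<Gamma> * real m))"

text \<open>\<open>return_time n A\<close> is \<open>\<pi>(A)\<close> for an \<open>n\<close>-cylinder \<open>A\<close>, \<open>n \<ge> 1\<close>; the set is then nonempty,
  as it contains \<open>n\<close>.\<close>

definition return_time :: "nat \<Rightarrow> (nat \<Rightarrow> 'a) set \<Rightarrow> nat" where
  "return_time n A = Min {k \<in> {1..n}. A \<inter> (shift ^^ k) -` A \<noteq> {}}"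

definition X :: "nat \<Rightarrow> (nat \<Rightarrow> nat) \<Rightarrow> (nat \<Rightarrow> 'a) set \<Rightarrow> nat \<Rightarrow> (nat \<Rightarrow> 'a) \<Rightarrow> nat" where
  "X l d A k \<omega> = (\<Prod>i=1..l. indicator A ((shift ^^ (d i * k)) \<omega>))"

definition S :: "nat \<Rightarrow> (nat \<Rightarrow> nat) \<Rightarrow> (nat \<Rightarrow> 'a) set \<Rightarrow> nat \<Rightarrow> (nat \<Rightarrow> 'a) \<Rightarrow> nat" where
  "S l d A N \<omega> = (\<Sum>k=1..N. X l d A k \<omega>)"

text \<open>\<open>periodic_cylinder b m\<close> is \<open>R\<^bsup>m/r\<^esup>\<close> for \<open>R = cylinder b\<close> and \<open>r = length b \<ge> 1\<close>.\<close>

definition periodic_cylinder :: "'a list \<Rightarrow> nat \<Rightarrow> (nat \<Rightarrow> 'a) set" where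
  "periodic_cylinder b m =
     (let r = length b in
       (\<Inter>k\<in>{..<m div r}. (shift ^^ (k * r)) -` cylinder b) \<inter>
       (shift ^^ (r * (m div r))) -` cylinder (take (m - r * (m div r)) b))"

definition kappa :: "nat \<Rightarrow> (nat \<Rightarrow> nat) \<Rightarrow> nat \<Rightarrow> nat" where
  "kappa l d r = Lcm {r div gcd r (d i) | i. i \<in> {1..l}}"

definition rho :: "(nat \<Rightarrow> 'a) measure \<Rightarrow> nat \<Rightarrow> (nat \<Rightarrow> nat) \<Rightarrow> 'a list \<Rightarrow> real" where
  "rho P l d a =
     (let n = length a; A = cylinder a; r = return_time n A; b = take r a; \<kappa> = kappa l d r in
       \<Prod>i=1..l. \<P>(\<omega> in P. \<omega> \<in> periodic_cylinder b (n + d i * \<kappa>) \<bar> \<omega> \<in> A))"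

text \<open>\<open>q\<close> is the probability of continuing, not of success.  That the \<open>\<zeta> j\<close>, \<open>j \<ge> 1\<close>, are
  independent and jointly independent of \<open>W\<close> is expressed as mutual independence of the family
  \<open>W, \<zeta> 1, \<zeta> 2, \<dots>\<close>; \<open>\<zeta> 0\<close> is not used.\<close>

definition poisson_geometric ::
  "'b measure \<Rightarrow> real \<Rightarrow> real \<Rightarrow> ('b \<Rightarrow> nat) \<Rightarrow> (nat \<Rightarrow> 'b \<Rightarrow> nat) \<Rightarrow> bool" where
  "poisson_geometric M \<theta> q W \<zeta> \<longleftrightarrow>
     prob_space M \<and>
     prob_space.indep_vars M (\<lambda>_. count_space UNIV) (\<lambda>j. if j = 0 then W else \<zeta> j) UNIV \<and>
     distr M (count_space UNIV) W = measure_pmf (poisson_pmf \<theta>) \<and>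
     (\<forall>j\<ge>1. \<forall>k\<ge>1. \<P>(x in M. \<zeta> j x = k) = (1 - q) * q ^ (k - 1))"

definition wp :: "real \<Rightarrow> real" where
  "wp x = x * exp x"

lemma cylinder_in_sets_PiM:
  "cylinder a \<in> sets (PiM UNIV (\<lambda>_::nat. count_space (UNIV :: 'a :: countable set)))"
proof -
  let ?M = "PiM UNIV (\<lambda>_::nat. count_space (UNIV :: 'a set))"
  have "{\<omega> \<in> space ?M. \<forall>i\<in>{..<length a}. \<omega> i = a ! i} \<in> sets ?M"
    by measurable
  thus ?thesis by (simp add: cylinder_def space_PiM PiE_UNIV_domain Ball_def)
qed

lemma sets_PiM_eq_sigma_cylinders:
  "sets (PiM UNIV (\<lambda>_::nat. count_space (UNIV :: 'a :: countable set))) =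
     sigma_sets UNIV (\<Union>n. cylinders n)" (is "sets ?M = ?S")
proof
  show "?S \<subseteq> sets ?M"
  proof -
    have "space ?M = UNIV" by (simp add: space_PiM PiE_UNIV_domain)
    moreover have "(\<Union>n. cylinders n) \<subseteq> sets ?M"
      using cylinder_in_sets_PiM by (auto simp: cylinders_def)
    ultimately show ?thesis using sets.sigma_sets_subset[of _ ?M] by metis
  qed
next
  interpret S: sigma_algebra UNIV ?S by (rule sigma_algebra_sigma_sets) auto
  have coord: "{\<omega>. \<omega> i \<in> B} \<in> ?S" for i :: nat and B :: "'a set"
  proof -
    have "{\<omega>. \<omega> i \<in> B} = (\<Union>a\<in>{a. length a = Suc i \<and> a ! i \<in> B}. cylinder a)"
    proof (intro equalityI subsetI)
      fix \<omega> :: "nat \<Rightarrow> 'a" assume "\<omega> \<in> {\<omega>. \<omega> i \<in> B}"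
      hence "\<omega> \<in> cylinder (map \<omega> [0..<Suc i])" "map \<omega> [0..<Suc i] ! i \<in> B"
        by (auto simp: cylinder_def nth_append simp del: upt_Suc)
      thus "\<omega> \<in> (\<Union>a\<in>{a. length a = Suc i \<and> a ! i \<in> B}. cylinder a)"
        by (intro UN_I[of "map \<omega> [0..<Suc i]"]) (auto simp del: upt_Suc)
    qed (auto simp: cylinder_def)
    also have "\<dots> \<in> ?S"
      by (intro S.countable_UN'') (auto intro!: sigma_sets.Basic simp: cylinders_def)
    finally show ?thesis .
  qed
  show "sets ?M \<subseteq> ?S"
    unfolding sets_PiM_single space_count_space PiE_UNIV_domain Pi_UNIV
    by (intro S.sigma_sets_subset) (auto simp: coord)
qed

end

theory Submission
  imports Defs
begin

text \<open>
  Let \<open>r = \<pi>(A)\<close>. Occurrences at distance less than \<open>n / (2 d\<^sub>l)\<close> are at a distance that is a multiple of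
  \<open>\<kappa>\<close>, so they arrange themselves into clumps, that is, runs along progressions of step \<open>\<kappa>\<close>. Up to
  events of small probability, \<open>S\<^sup>A\<^sub>N\<close> is the sum over \<open>k\<close> of the length \<open>\<xi>\<^sub>k\<close> (cut off at \<open>n\<close>) of the clump
  that starts at \<open>k\<close>. For \<open>k\<close> not too small the blocks read by the \<open>l\<close> factors are disjoint, and
  independence of the letters gives exactly \<open>\<P>(\<xi>\<^sub>k > j) = \<P>(A)\<^sup>l (1 - \<rho>) \<rho>\<^sup>j\<close> for \<open>j < n\<close>.

  The summands \<open>\<xi>\<^sub>k\<close> are replaced one after the other, as in Lindeberg's method, by independent variables
  that vanish with probability \<open>1 - \<P>(A)\<^sup>l (1 - \<rho>)\<close> and are geometric otherwise. Each \<open>\<xi>\<^sub>k\<close> is independent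
  of all but \<open>O(l\<^sup>2 d\<^sub>l n\<^sup>2)\<close> of the others, and for \<open>i \<noteq> k\<close> both \<open>\<xi>\<^sub>i\<close> and \<open>\<xi>\<^sub>k\<close> are nonzero with
  probability at most \<open>\<P>(A)\<^sup>l e\<^bsup>-\<Gamma>n/2\<^esup>\<close>: nearby clumps exclude each other, and for distant ones at
  least half of the letters in the last block of the later one are not read by the earlier one. Since
  the test functions are only required to take values in \<open>[0, 1]\<close>, this bounds the total variation
  distance. The resulting compound binomial law is compared with the compound Poisson law through
  the differential equation satisfied by Poisson means.
\<close>

section \<open>Geometric and Poisson means\<close>

text \<open>The averaging operators below all preserve this class, and increments of its members are
  at most 1. Indicators of sets belong to it, so a bound uniform over the class bounds the total
  variation distance.\<close>

definition unit_fun :: "(nat \<Rightarrow> real) \<Rightarrow> bool" where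
  "unit_fun g \<longleftrightarrow> (\<forall>x. 0 \<le> g x \<and> g x \<le> 1)"

lemma unit_fun_diff_le:
  assumes "unit_fun g"
  shows "\<bar>g x - g y\<bar> \<le> 1"
proof -
  have "0 \<le> g x" "g x \<le> 1" "0 \<le> g y" "g y \<le> 1" using assms by (auto simp: unit_fun_def)
  thus ?thesis by linarith
qed

text \<open>The mean of \<open>g (x + Z)\<close> for \<open>Z\<close> geometric on 1, 2, ... with
  tails \<open>P (Z > j) = \<rho> ^ j\<close>. Laws are treated as operators on test functions, so
  that adding an independent summand becomes composing operators.\<close>

definition geom_mean :: "real \<Rightarrow> (nat \<Rightarrow> real) \<Rightarrow> nat \<Rightarrow> real" where
  "geom_mean \<rho> g x = (\<Sum>j. (1 - \<rho>) * \<rho> ^ j * g (x + 1 + j))"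

text \<open>The mean of \<open>g (x + B * Z)\<close> with \<open>Z\<close> as above and an
  independent Bernoulli variable \<open>B\<close> of parameter \<open>p\<close>: the law that
  replaces a single clump.\<close>

definition thinned_step :: "real \<Rightarrow> real \<Rightarrow> (nat \<Rightarrow> real) \<Rightarrow> nat \<Rightarrow> real" where
  "thinned_step p \<rho> g x = (1 - p) * g x + p * geom_mean \<rho> g x"

context
  fixes \<rho> :: real
  assumes rho: "0 \<le> \<rho>" "\<rho> < 1"
begin

lemma summable_geom_mean:
  assumes "unit_fun g"
  shows "summable (\<lambda>j. (1 - \<rho>) * \<rho> ^ j * g (x + 1 + j))"
proof (rule summable_comparison_test')
  show "summable (\<lambda>j. (1 - \<rho>) * \<rho> ^ j)"
    using rho by (intro summable_mult summable_geometric) auto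
  show "norm ((1 - \<rho>) * \<rho> ^ j * g (x + 1 + j)) \<le> (1 - \<rho>) * \<rho> ^ j" for j
    using rho assms by (auto simp: abs_mult unit_fun_def mult_left_le)
qed

lemma suminf_geom: "(\<Sum>j. (1 - \<rho>) * \<rho> ^ j) = 1"
  using rho by (subst suminf_mult) (auto simp: suminf_geometric summable_geometric)

lemma unit_fun_geom_mean:
  assumes "unit_fun g"
  shows "unit_fun (geom_mean \<rho> g)"
  unfolding unit_fun_def
proof (intro allI conjI)
  fix x
  show "0 \<le> geom_mean \<rho> g x"
    unfolding geom_mean_def using rho assms
    by (intro suminf_nonneg summable_geom_mean) (auto simp: unit_fun_def)
  have "geom_mean \<rho> g x \<le> (\<Sum>j. (1 - \<rho>) * \<rho> ^ j)"
    unfolding geom_mean_def using rho assms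
    by (intro suminf_le summable_geom_mean summable_mult summable_geometric)
       (auto simp: unit_fun_def mult_left_le)
  thus "geom_mean \<rho> g x \<le> 1" by (simp add: suminf_geom)
qed

text \<open>Lack of memory: either \<open>Z = 1\<close>, or \<open>Z - 1\<close> is again
  geometric.\<close>

lemma geom_mean_rec:
  assumes "unit_fun g"
  shows "geom_mean \<rho> g x = (1 - \<rho>) * g (Suc x) + \<rho> * geom_mean \<rho> g (Suc x)"
proof -
  have "geom_mean \<rho> g x = (1 - \<rho>) * g (Suc x) + (\<Sum>j. (1 - \<rho>) * \<rho> ^ Suc j * g (x + 1 + Suc j))"
    unfolding geom_mean_def using suminf_split_head[OF summable_geom_mean[OF assms, of x]] by simp
  also have "(\<lambda>j. (1 - \<rho>) * \<rho> ^ Suc j * g (x + 1 + Suc j))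
      = (\<lambda>j. \<rho> * ((1 - \<rho>) * \<rho> ^ j * g (Suc x + 1 + j)))"
    by (auto simp: fun_eq_iff)
  also have "suminf \<dots> = \<rho> * geom_mean \<rho> g (Suc x)"
    unfolding geom_mean_def by (rule suminf_mult[OF summable_geom_mean[OF assms, of "Suc x"]])
  finally show ?thesis .
qed

text \<open>Lack of memory, applied \<open>J\<close> times. The increment of \<open>g\<close> at
  level \<open>j\<close> is weighted by the tail \<open>\<rho> ^ j\<close>, so another variable can
  be compared with a geometric one through its tails alone.\<close>

lemma geom_mean_diff:
  assumes "unit_fun g"
  shows "geom_mean \<rho> g x - g x
    = (\<Sum>j<J. \<rho> ^ j * (g (x + Suc j) - g (x + j))) + \<rho> ^ J * (geom_mean \<rho> g (x + J) - g (x + J))"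
proof (induction J)
  case (Suc J)
  show ?case
    unfolding Suc.IH geom_mean_rec[OF assms, of "x + J"] by (simp add: algebra_simps)
qed simp

lemma geom_mean_linear:
  assumes "unit_fun g" "unit_fun h"
  shows "geom_mean \<rho> (\<lambda>x. a * g x + b * h x) x = a * geom_mean \<rho> g x + b * geom_mean \<rho> h x"
proof -
  have "geom_mean \<rho> (\<lambda>x. a * g x + b * h x) x
     = (\<Sum>j. a * ((1 - \<rho>) * \<rho> ^ j * g (x + 1 + j)) + b * ((1 - \<rho>) * \<rho> ^ j * h (x + 1 + j)))"
    unfolding geom_mean_def by (simp add: algebra_simps)
  also have "\<dots> = a * geom_mean \<rho> g x + b * geom_mean \<rho> h x"
    unfolding geom_mean_def using summable_geom_mean[OF assms(1), of x] summable_geom_mean[OF assms(2), of x]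
    by (subst suminf_add[symmetric]) (auto simp only: suminf_mult intro!: summable_mult)
  finally show ?thesis .
qed

lemma unit_fun_geom_mean_pow: "unit_fun g \<Longrightarrow> unit_fun ((geom_mean \<rho> ^^ m) g)"
  by (induction m) (auto intro: unit_fun_geom_mean)

lemma unit_fun_thinned_step:
  assumes "unit_fun g" "0 \<le> p" "p \<le> 1"
  shows "unit_fun (thinned_step p \<rho> g)"
proof -
  have "0 \<le> (1 - p) * u + p * v \<and> (1 - p) * u + p * v \<le> 1"
    if "0 \<le> u \<and> u \<le> 1" "0 \<le> v \<and> v \<le> 1" for u v :: real
    using that assms(2,3) convex_bound_le[of u 1 v "1 - p" p] by auto
  thus ?thesis
    using assms(1) unit_fun_geom_mean[OF assms(1)] unfolding unit_fun_def thinned_step_def by blast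
qed

text \<open>The number of nonzero summands evolves under \<open>thinned_step\<close> as a Bernoulli walk that acts on
  the sequence of iterates of \<open>geom_mean\<close>.\<close>

lemma thinned_step_pow:
  assumes "unit_fun h" "0 \<le> p" "p \<le> 1"
  shows "(geom_mean \<rho> ^^ m) ((thinned_step p \<rho> ^^ M) h) x
    = ((\<lambda>c m. (1 - p) * c m + p * c (Suc m)) ^^ M) (\<lambda>m. (geom_mean \<rho> ^^ m) h x) m"
proof (induction M arbitrary: m)
  case (Suc M)
  let ?g = "(thinned_step p \<rho> ^^ M) h"
  have uf: "unit_fun ?g"
    using assms by (induction M) (auto intro: unit_fun_thinned_step)
  \<comment> \<open>By linearity the powers of \<open>geom_mean\<close> pass through the convex
    combination in \<open>thinned_step\<close>.\<close>
  have "(geom_mean \<rho> ^^ m) (thinned_step p \<rho> ?g)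
      = (\<lambda>y. (1 - p) * (geom_mean \<rho> ^^ m) ?g y + p * (geom_mean \<rho> ^^ Suc m) ?g y)"
  proof (induction m)
    case 0 show ?case by (simp add: thinned_step_def fun_eq_iff)
  next
    case (Suc m)
    have "geom_mean \<rho> (\<lambda>y. (1 - p) * (geom_mean \<rho> ^^ m) ?g y + p * (geom_mean \<rho> ^^ Suc m) ?g y) x
      = (1 - p) * geom_mean \<rho> ((geom_mean \<rho> ^^ m) ?g) x
        + p * geom_mean \<rho> ((geom_mean \<rho> ^^ Suc m) ?g) x" for x
      by (intro geom_mean_linear unit_fun_geom_mean_pow uf)
    with Suc show ?case by simp
  qed
  with Suc.IH[of m] Suc.IH[of "Suc m"] show ?case by simp
qed simp

end

section \<open>Means of \<open>c (x + W)\<close> for a Poisson variable \<open>W\<close>, as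
  functions of its parameter \<open>s\<close>\<close>

definition poisson_mean :: "(nat \<Rightarrow> real) \<Rightarrow> real \<Rightarrow> nat \<Rightarrow> real" where
  "poisson_mean c s x = exp (- s) * (\<Sum>n. c (x + n) / fact n * s ^ n)"

text \<open>The sign of \<open>s\<close> is free, since termwise differentiation asks for
  convergence at every real argument.\<close>

lemma summable_poisson_mean:
  assumes "unit_fun c"
  shows "summable (\<lambda>n. c (x + n) / fact n * s ^ n)"
proof (rule summable_comparison_test')
  show "summable (\<lambda>n. \<bar>s\<bar> ^ n /\<^sub>R fact n)" by (rule summable_exp_generic)
  show "norm (c (x + n) / fact n * s ^ n) \<le> \<bar>s\<bar> ^ n /\<^sub>R fact n" for n
  proof -
    have "\<bar>c (x + n)\<bar> * \<bar>s\<bar> ^ n \<le> 1 * \<bar>s\<bar> ^ n"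
      using assms by (intro mult_right_mono) (auto simp: unit_fun_def)
    thus ?thesis by (simp add: abs_mult power_abs divide_simps)
  qed
qed

text \<open>Differentiating the power series shifts its coefficients by one index; the factor
  \<open>exp (- s)\<close> contributes the negative term.\<close>

lemma poisson_mean_deriv:
  assumes "unit_fun c"
  shows "((\<lambda>s. poisson_mean c s x) has_real_derivative
           poisson_mean c s (Suc x) - poisson_mean c s x) (at s)"
proof -
  have "((\<lambda>s. \<Sum>n. c (x + n) / fact n * s ^ n) has_real_derivative
      (\<Sum>n. diffs (\<lambda>n. c (x + n) / fact n) n * s ^ n)) (at s)"
    by (rule termdiffs_strong_converges_everywhere) (rule summable_poisson_mean[OF assms])
  moreover have "diffs (\<lambda>n. c (x + n) / fact n) = (\<lambda>n. c (Suc x + n) / fact n)"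
    by (auto simp: diffs_def fun_eq_iff divide_simps)
  ultimately show ?thesis
    unfolding poisson_mean_def by (auto intro!: derivative_eq_intros simp: algebra_simps)
qed

lemma unit_fun_poisson_mean:
  assumes "unit_fun c" "0 \<le> s"
  shows "unit_fun (poisson_mean c s)"
  unfolding unit_fun_def
proof (intro allI conjI)
  fix x
  show "0 \<le> poisson_mean c s x"
    unfolding poisson_mean_def using assms
    by (intro mult_nonneg_nonneg suminf_nonneg summable_poisson_mean) (auto simp: unit_fun_def)
  have "(\<Sum>n. c (x + n) / fact n * s ^ n) \<le> (\<Sum>n. s ^ n /\<^sub>R fact n)"
  proof (intro suminf_le summable_poisson_mean assms(1) summable_exp_generic)
    fix n
    have "c (x + n) * s ^ n \<le> 1 * s ^ n"
      using assms by (intro mult_right_mono) (auto simp: unit_fun_def)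
    thus "c (x + n) / fact n * s ^ n \<le> s ^ n /\<^sub>R fact n" by (simp add: divide_simps)
  qed
  also have "\<dots> = exp s" by (simp add: exp_def)
  finally show "poisson_mean c s x \<le> 1"
    unfolding poisson_mean_def by (simp add: exp_minus field_simps)
qed

text \<open>The derivative is a difference of two values of a function into [0, 1], hence at most 1
  in modulus.\<close>

lemma poisson_mean_lipschitz:
  assumes "unit_fun c" "0 \<le> s" "0 \<le> u"
  shows "\<bar>poisson_mean c s x - poisson_mean c u x\<bar> \<le> \<bar>s - u\<bar>"
proof -
  have *: "\<bar>poisson_mean c s x - poisson_mean c u x\<bar> \<le> \<bar>s - u\<bar>" if "u < s" "0 \<le> u" for s u
  proof -
    have "\<exists>z>u. z < s \<and> poisson_mean c s x - poisson_mean c u x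
         = (s - u) * (poisson_mean c z (Suc x) - poisson_mean c z x)"
      by (intro MVT2 poisson_mean_deriv assms that)
    then obtain z where z: "u < z" "z < s"
      "poisson_mean c s x - poisson_mean c u x
         = (s - u) * (poisson_mean c z (Suc x) - poisson_mean c z x)"
      by blast
    have "\<bar>poisson_mean c z (Suc x) - poisson_mean c z x\<bar> \<le> 1"
      using z that by (intro unit_fun_diff_le unit_fun_poisson_mean assms) auto
    thus ?thesis using z that by (simp add: abs_mult mult_left_le)
  qed
  show ?thesis
    using *[of u s] *[of s u] assms by (cases u s rule: linorder_cases) (auto simp: abs_minus_commute)
qed

text \<open>To first order a Bernoulli step advances the Poisson parameter by \<open>p\<close>. The
  mean value theorem gives the increment with the derivative at some \<open>z\<close> between
  \<open>s\<close> and \<open>s + p\<close>, and each of the two terms of that derivative moves by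
  at most \<open>p\<close> between \<open>s\<close> and \<open>z\<close>.\<close>

lemma poisson_mean_step:
  assumes "unit_fun c" "0 \<le> s" "0 \<le> p"
  shows "\<bar>(1 - p) * poisson_mean c s x + p * poisson_mean c s (Suc x) - poisson_mean c (s + p) x\<bar>
    \<le> 2 * p\<^sup>2"
proof (cases "p = 0")
  case False
  let ?v = "poisson_mean c"
  have "\<exists>z>s. z < s + p \<and> ?v (s + p) x - ?v s x = (s + p - s) * (?v z (Suc x) - ?v z x)"
    using False assms by (intro MVT2 poisson_mean_deriv) auto
  then obtain z where z: "s < z" "z < s + p"
    "?v (s + p) x - ?v s x = p * (?v z (Suc x) - ?v z x)"
    by auto
  have "\<bar>?v s (Suc x) - ?v z (Suc x)\<bar> \<le> p" "\<bar>?v s x - ?v z x\<bar> \<le> p"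
    using poisson_mean_lipschitz[OF assms(1,2), of z x]
      poisson_mean_lipschitz[OF assms(1,2), of z "Suc x"] z assms(2) by linarith+
  hence "\<bar>(?v s (Suc x) - ?v z (Suc x)) - (?v s x - ?v z x)\<bar> \<le> 2 * p" by linarith
  hence "p * \<bar>(?v s (Suc x) - ?v z (Suc x)) - (?v s x - ?v z x)\<bar> \<le> p * (2 * p)"
    using assms(3) by (rule mult_left_mono)
  moreover have "(1 - p) * ?v s x + p * ?v s (Suc x) - ?v (s + p) x
      = p * ((?v s (Suc x) - ?v z (Suc x)) - (?v s x - ?v z x))"
    using z(3) by (simp add: algebra_simps)
  ultimately show ?thesis using assms(3) by (simp add: abs_mult power2_eq_square)
qed simp

text \<open>The errors of single steps simply add up: a Bernoulli step is a convex combination, so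
  it does not enlarge a uniform bound on a difference.\<close>

lemma binomial_poisson:
  assumes "unit_fun c" "0 \<le> p" "p \<le> 1"
  shows "\<bar>((\<lambda>c m. (1 - p) * c m + p * c (Suc m)) ^^ M) c m - poisson_mean c (real M * p) m\<bar>
    \<le> 2 * real M * p\<^sup>2"
proof (induction M arbitrary: m)
  case 0
  have "(\<Sum>n. c (m + n) / fact n * (0::real) ^ n) = c m"
    by (subst suminf_finite[of "{0}"]) auto
  thus ?case by (simp add: poisson_mean_def)
next
  case (Suc M)
  let ?b = "(\<lambda>c m. (1 - p) * c m + p * c (Suc m)) :: (nat \<Rightarrow> real) \<Rightarrow> nat \<Rightarrow> real"
  let ?w = "(?b ^^ M) c" and ?v = "poisson_mean c (real M * p)"
  let ?E = "2 * real M * p\<^sup>2"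
  have "\<bar>(1 - p) * (?w m - ?v m)\<bar> \<le> (1 - p) * ?E" "\<bar>p * (?w (Suc m) - ?v (Suc m))\<bar> \<le> p * ?E"
    unfolding abs_mult using Suc.IH assms by (auto intro!: mult_mono)
  hence "\<bar>(1 - p) * (?w m - ?v m) + p * (?w (Suc m) - ?v (Suc m))\<bar> \<le> ?E"
    by (simp add: algebra_simps)
  hence 1: "\<bar>?b ?w m - ?b ?v m\<bar> \<le> ?E" by (simp add: algebra_simps)
  have 2: "\<bar>?b ?v m - poisson_mean c (real M * p + p) m\<bar> \<le> 2 * p\<^sup>2"
    using assms by (intro poisson_mean_step) auto
  have "real (Suc M) * p = real M * p + p" "2 * real (Suc M) * p\<^sup>2 = ?E + 2 * p\<^sup>2"
    by (auto simp: algebra_simps)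
  with 1 2 show ?case by simp
qed

text \<open>For fixed \<open>x\<close> the iterates of \<open>geom_mean\<close> form a sequence in
  the number \<open>m\<close> of nonzero summands, to which the binomial comparison applies. The
  Lipschitz bound then corrects the parameter \<open>M * p\<close> to
  \<open>\<theta>\<close>.\<close>

lemma thinned_step_poisson:
  assumes "unit_fun h" "0 \<le> \<rho>" "\<rho> < 1" "0 \<le> p" "p \<le> 1" "0 \<le> \<theta>"
  shows "\<bar>(thinned_step p \<rho> ^^ M) h x - poisson_mean (\<lambda>m. (geom_mean \<rho> ^^ m) h x) \<theta> 0\<bar>
    \<le> 2 * real M * p\<^sup>2 + \<bar>real M * p - \<theta>\<bar>"
proof -
  let ?c = "\<lambda>m. (geom_mean \<rho> ^^ m) h x"
  have c: "unit_fun ?c"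
    using unit_fun_geom_mean_pow[OF assms(2,3,1)] by (auto simp: unit_fun_def)
  have "(thinned_step p \<rho> ^^ M) h x = ((\<lambda>c m. (1 - p) * c m + p * c (Suc m)) ^^ M) ?c 0"
    using thinned_step_pow[OF assms(2,3,1,4,5), of 0 M x] by simp
  moreover note binomial_poisson[OF c assms(4,5), of M 0]
  moreover have "\<bar>poisson_mean ?c (real M * p) 0 - poisson_mean ?c \<theta> 0\<bar> \<le> \<bar>real M * p - \<theta>\<bar>"
    using assms by (intro poisson_mean_lipschitz c) auto
  ultimately show ?thesis by linarith
qed

section \<open>Lindeberg replacement under local dependence\<close>

lemma measurable_nat_fun2:
  fixes U V :: "'a \<Rightarrow> nat"
  assumes "V \<in> measurable M (count_space UNIV)" "U \<in> measurable M (count_space UNIV)" "space N = UNIV"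
  shows "(\<lambda>\<omega>. f (V \<omega>) (U \<omega>)) \<in> measurable M N"
proof -
  have "(\<lambda>\<omega>. f i (U \<omega>)) \<in> measurable M N" for i
    by (rule measurable_compose[OF assms(2)]) (auto simp: assms(3))
  from measurable_compose_countable[OF this assms(1)] show ?thesis .
qed

text \<open>Each layer separates \<open>x\<close> from the base point \<open>v\<close>, so its
  expectation factors under independence. This is the counterpart of \<open>geom_mean_diff\<close>
  for a bounded variable.\<close>

lemma telescope_of_bool:
  fixes g :: "nat \<Rightarrow> real"
  assumes "x \<le> J"
  shows "g (v + x) - g v = (\<Sum>j<J. of_bool (j < x) * (g (v + Suc j) - g (v + j)))"
proof -
  have "(\<Sum>j<J. of_bool (j < x) * (g (v + Suc j) - g (v + j))) = (\<Sum>j<x. g (v + Suc j) - g (v + j))"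
    using assms by (intro sum.mono_neutral_cong_right) auto
  also have "\<dots> = g (v + x) - g v" using sum_lessThan_telescope[of "\<lambda>j. g (v + j)" x] by simp
  finally show ?thesis ..
qed

context prob_space
begin

lemma abs_expectation_diff_le:
  fixes f h :: "'a \<Rightarrow> real"
  assumes "integrable M f" "integrable M h" "E \<in> events" "0 \<le> c"
    and "\<And>\<omega>. \<omega> \<in> space M \<Longrightarrow> \<bar>f \<omega> - h \<omega>\<bar> \<le> c * indicator E \<omega>"
  shows "\<bar>expectation f - expectation h\<bar> \<le> c * prob E"
proof -
  have E: "integrable M (\<lambda>\<omega>. c * indicator E \<omega>)"
    using assms(3) by (intro integrable_mult_right integrable_real_indicator) (auto simp: less_top[symmetric])
  have "\<bar>expectation f - expectation h\<bar> = \<bar>\<integral>\<omega>. f \<omega> - h \<omega> \<partial>M\<bar>"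
    using assms by simp
  also have "\<dots> \<le> (\<integral>\<omega>. \<bar>f \<omega> - h \<omega>\<bar> \<partial>M)" by (rule integral_abs_bound)
  also have "\<dots> \<le> (\<integral>\<omega>. c * indicator E \<omega> \<partial>M)"
    using assms E by (intro integral_mono integrable_abs Bochner_Integration.integrable_diff) auto
  also have "\<dots> = c * prob E" using sets.sets_into_space[OF assms(3)] by (simp add: Int_absorb2)
  finally show ?thesis .
qed

text \<open>Away from the event that both \<open>\<xi>\<close> and \<open>U\<close> are nonzero, \<open>U\<close> may be dropped; once it is dropped,
  independence of \<open>\<xi>\<close> and \<open>V\<close> evaluates the increment exactly.\<close>

lemma thinned_step_replacement:
  fixes \<xi> U V :: "'a \<Rightarrow> nat"
  assumes indep: "indep_var (count_space UNIV) \<xi> (count_space UNIV) V"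
    and U: "U \<in> measurable M (count_space UNIV)"
    and bound: "\<And>\<omega>. \<omega> \<in> space M \<Longrightarrow> \<xi> \<omega> \<le> J"
    and tail: "\<And>j. j < J \<Longrightarrow> prob {\<omega> \<in> space M. j < \<xi> \<omega>} = p * \<rho> ^ j"
    and g: "unit_fun g" and \<rho>: "0 \<le> \<rho>" "\<rho> < 1" and p: "0 \<le> p" "p \<le> 1"
  shows "\<bar>expectation (\<lambda>\<omega>. g (V \<omega> + U \<omega> + \<xi> \<omega>)) - expectation (\<lambda>\<omega>. thinned_step p \<rho> g (V \<omega> + U \<omega>))\<bar>
    \<le> 2 * prob {\<omega> \<in> space M. \<xi> \<omega> \<noteq> 0 \<and> U \<omega> \<noteq> 0} + 2 * p * prob {\<omega> \<in> space M. U \<omega> \<noteq> 0} + p * \<rho> ^ J"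
proof -
  let ?D = "\<lambda>j x. g (x + Suc j) - g (x + j)" and ?k = "geom_mean \<rho> g"
  have V: "V \<in> measurable M (count_space UNIV)" and \<xi>: "\<xi> \<in> measurable M (count_space UNIV)"
    using indep_var_rv1[OF indep] indep_var_rv2[OF indep] by auto
  have VU: "(\<lambda>\<omega>. V \<omega> + U \<omega>) \<in> measurable M (count_space UNIV)"
    by (rule measurable_nat_fun2[OF V U]) simp
  have meas: "(\<lambda>\<omega>. f (V \<omega> + U \<omega>) (\<xi> \<omega>)) \<in> borel_measurable M"
             "(\<lambda>\<omega>. f (V \<omega>) (\<xi> \<omega>)) \<in> borel_measurable M" for f :: "nat \<Rightarrow> nat \<Rightarrow> real"
    by (rule measurable_nat_fun2[OF VU \<xi>] measurable_nat_fun2[OF V \<xi>], simp)+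
  have k: "unit_fun ?k" using g \<rho> by (intro unit_fun_geom_mean)
  have D: "\<bar>?D j x\<bar> \<le> 1" for j x by (rule unit_fun_diff_le[OF g])
  have int: "integrable M (\<lambda>\<omega>. g (V \<omega> + U \<omega> + \<xi> \<omega>))" "integrable M (\<lambda>\<omega>. g (V \<omega> + U \<omega>))"
    "integrable M (\<lambda>\<omega>. g (V \<omega> + \<xi> \<omega>))" "integrable M (\<lambda>\<omega>. g (V \<omega>))"
    "integrable M (\<lambda>\<omega>. ?k (V \<omega> + U \<omega>))" "integrable M (\<lambda>\<omega>. ?k (V \<omega>))"
    "integrable M (\<lambda>\<omega>. ?D j (V \<omega>))" for j
    using meas(1)[of "\<lambda>x y. g (x + y)"] meas(1)[of "\<lambda>x y. g x"] meas(2)[of "\<lambda>x y. g (x + y)"]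
      meas(2)[of "\<lambda>x y. g x"] meas(1)[of "\<lambda>x y. ?k x"] meas(2)[of "\<lambda>x y. ?k x"] meas(2)[of "\<lambda>x y. ?D j x"]
      g k D
    by (auto simp: unit_fun_def intro!: integrable_const_bound[where B = 1])
  have ev1: "{\<omega> \<in> space M. \<xi> \<omega> \<noteq> 0 \<and> U \<omega> \<noteq> 0} \<in> events" and ev2: "{\<omega> \<in> space M. U \<omega> \<noteq> 0} \<in> events"
    using \<xi> U by measurable
  \<comment> \<open>Both increments vanish where \<open>\<xi>\<close> does, and they coincide where
    \<open>U\<close> vanishes.\<close>
  have 1: "\<bar>expectation (\<lambda>\<omega>. g (V \<omega> + U \<omega> + \<xi> \<omega>) - g (V \<omega> + U \<omega>)) - expectation (\<lambda>\<omega>. g (V \<omega> + \<xi> \<omega>) - g (V \<omega>))\<bar>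
      \<le> 2 * prob {\<omega> \<in> space M. \<xi> \<omega> \<noteq> 0 \<and> U \<omega> \<noteq> 0}"
  proof (intro abs_expectation_diff_le)
    fix \<omega> assume \<omega>: "\<omega> \<in> space M"
    have "\<bar>g (V \<omega> + U \<omega> + \<xi> \<omega>) - g (V \<omega> + U \<omega>)\<bar> \<le> 1" "\<bar>g (V \<omega> + \<xi> \<omega>) - g (V \<omega>)\<bar> \<le> 1"
      by (rule unit_fun_diff_le[OF g])+
    thus "\<bar>g (V \<omega> + U \<omega> + \<xi> \<omega>) - g (V \<omega> + U \<omega>) - (g (V \<omega> + \<xi> \<omega>) - g (V \<omega>))\<bar>
      \<le> 2 * indicator {\<omega> \<in> space M. \<xi> \<omega> \<noteq> 0 \<and> U \<omega> \<noteq> 0} \<omega>"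
      using \<omega> by (auto simp: indicator_def)
  qed (use int ev1 in auto)
  \<comment> \<open>The same removal of \<open>U\<close> for the geometric increment; it is later
    multiplied by \<open>p\<close>, so here \<open>U \<noteq> 0\<close> alone is a sufficiently
    small event.\<close>
  have 2: "\<bar>expectation (\<lambda>\<omega>. ?k (V \<omega> + U \<omega>) - g (V \<omega> + U \<omega>)) - expectation (\<lambda>\<omega>. ?k (V \<omega>) - g (V \<omega>))\<bar>
      \<le> 2 * prob {\<omega> \<in> space M. U \<omega> \<noteq> 0}"
  proof (intro abs_expectation_diff_le)
    fix \<omega> assume \<omega>: "\<omega> \<in> space M"
    have "\<bar>?k (V \<omega> + U \<omega>) - ?k (V \<omega>)\<bar> \<le> 1" "\<bar>g (V \<omega> + U \<omega>) - g (V \<omega>)\<bar> \<le> 1"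
      by (rule unit_fun_diff_le[OF g] unit_fun_diff_le[OF k])+
    thus "\<bar>?k (V \<omega> + U \<omega>) - g (V \<omega> + U \<omega>) - (?k (V \<omega>) - g (V \<omega>))\<bar>
      \<le> 2 * indicator {\<omega> \<in> space M. U \<omega> \<noteq> 0} \<omega>"
      using \<omega> by (auto simp: indicator_def)
  qed (use int ev2 in auto)
  have prod: "expectation (\<lambda>\<omega>. of_bool (j < \<xi> \<omega>) * ?D j (V \<omega>)) = p * \<rho> ^ j * expectation (\<lambda>\<omega>. ?D j (V \<omega>))"
    if "j < J" for j
  proof -
    have "indep_var borel ((\<lambda>x. of_bool (j < x) :: real) \<circ> \<xi>) borel (?D j \<circ> V)"
      by (rule indep_var_compose[OF indep]) auto
    hence "expectation (\<lambda>\<omega>. of_bool (j < \<xi> \<omega>) * ?D j (V \<omega>))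
        = expectation (\<lambda>\<omega>. of_bool (j < \<xi> \<omega>)) * expectation (\<lambda>\<omega>. ?D j (V \<omega>))"
      using int(7)[of j] meas(2)[of "\<lambda>x y. of_bool (j < y)"]
      by (subst indep_var_lebesgue_integral[symmetric])
         (auto simp: o_def intro!: integrable_const_bound[where B = 1])
    also have "expectation (\<lambda>\<omega>. of_bool (j < \<xi> \<omega>)) = expectation (indicator {\<omega> \<in> space M. j < \<xi> \<omega>})"
      by (intro Bochner_Integration.integral_cong) (auto simp: indicator_def)
    also have "\<dots> = p * \<rho> ^ j"
      using tail[OF that] by (simp add: Int_absorb2[OF Collect_restrict])
    finally show ?thesis .
  qed
  have "expectation (\<lambda>\<omega>. g (V \<omega> + \<xi> \<omega>) - g (V \<omega>))
      = expectation (\<lambda>\<omega>. \<Sum>j<J. of_bool (j < \<xi> \<omega>) * ?D j (V \<omega>))"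
    by (intro Bochner_Integration.integral_cong refl telescope_of_bool bound)
  also have "\<dots> = (\<Sum>j<J. expectation (\<lambda>\<omega>. of_bool (j < \<xi> \<omega>) * ?D j (V \<omega>)))"
  proof (intro Bochner_Integration.integral_sum integrable_const_bound[where B = 1] AE_I2)
    show "norm (of_bool (j < \<xi> \<omega>) * ?D j (V \<omega>)) \<le> 1" for j \<omega>
      using D[of "V \<omega>" j] by (auto simp: of_bool_def)
  qed (rule meas(2))
  also have "\<dots> = p * (\<Sum>j<J. \<rho> ^ j * expectation (\<lambda>\<omega>. ?D j (V \<omega>)))"
    using prod by (simp add: sum_distrib_left mult.assoc)
  also have "(\<Sum>j<J. \<rho> ^ j * expectation (\<lambda>\<omega>. ?D j (V \<omega>))) = expectation (\<lambda>\<omega>. \<Sum>j<J. \<rho> ^ j * ?D j (V \<omega>))"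
    using int(7) by (simp del: Bochner_Integration.integral_diff)
  finally have 3: "expectation (\<lambda>\<omega>. g (V \<omega> + \<xi> \<omega>) - g (V \<omega>)) = p * expectation (\<lambda>\<omega>. \<Sum>j<J. \<rho> ^ j * ?D j (V \<omega>))" .
  \<comment> \<open>The cap \<open>J\<close> on \<open>\<xi>\<close> leaves only the remainder of
    \<open>geom_mean_diff\<close>, the part of the geometric variable beyond
    \<open>J\<close>.\<close>
  have 4: "\<bar>expectation (\<lambda>\<omega>. ?k (V \<omega>) - g (V \<omega>)) - expectation (\<lambda>\<omega>. \<Sum>j<J. \<rho> ^ j * ?D j (V \<omega>))\<bar>
      \<le> \<rho> ^ J * prob (space M)"
  proof (intro abs_expectation_diff_le)
    fix \<omega> assume "\<omega> \<in> space M"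
    have "\<bar>?k (V \<omega> + J) - g (V \<omega> + J)\<bar> \<le> 1"
      using g k unfolding unit_fun_def by (smt (verit))
    thus "\<bar>?k (V \<omega>) - g (V \<omega>) - (\<Sum>j<J. \<rho> ^ j * ?D j (V \<omega>))\<bar> \<le> \<rho> ^ J * indicator (space M) \<omega>"
      using \<rho> \<open>\<omega> \<in> space M\<close> by (subst geom_mean_diff[OF \<rho> g, of _ J]) (auto simp: abs_mult mult_left_le)
  qed (use int \<rho> in auto)
  have step: "expectation (\<lambda>\<omega>. thinned_step p \<rho> g (V \<omega> + U \<omega>))
    = expectation (\<lambda>\<omega>. g (V \<omega> + U \<omega>)) + p * expectation (\<lambda>\<omega>. ?k (V \<omega> + U \<omega>) - g (V \<omega> + U \<omega>))"
    unfolding thinned_step_def using int by (simp add: algebra_simps)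
  define e1 e2 e3 where "e1 = expectation (\<lambda>\<omega>. ?k (V \<omega> + U \<omega>) - g (V \<omega> + U \<omega>))"
    and "e2 = expectation (\<lambda>\<omega>. ?k (V \<omega>) - g (V \<omega>))"
    and "e3 = expectation (\<lambda>\<omega>. \<Sum>j<J. \<rho> ^ j * ?D j (V \<omega>))"
  have "\<bar>e3 - e1\<bar> \<le> 2 * prob {\<omega> \<in> space M. U \<omega> \<noteq> 0} + \<rho> ^ J"
    using 2 4 unfolding e1_def[symmetric] e2_def[symmetric] e3_def[symmetric] by (simp add: prob_space)
  hence "\<bar>p * e3 - p * e1\<bar> \<le> p * (2 * prob {\<omega> \<in> space M. U \<omega> \<noteq> 0} + \<rho> ^ J)"
    using p by (simp add: right_diff_distrib[symmetric] abs_mult mult_left_mono)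
  hence "\<bar>p * e3 - p * e1\<bar> \<le> 2 * p * prob {\<omega> \<in> space M. U \<omega> \<noteq> 0} + p * \<rho> ^ J"
    by (simp add: algebra_simps)
  with 1 show ?thesis
    unfolding step 3 e1_def[symmetric] e3_def[symmetric] using int by simp
qed

text \<open>The last summand is replaced first; this turns the test function \<open>h\<close> into
  \<open>thinned_step p \<rho> h\<close>, again a \<open>unit_fun\<close>, and the induction goes on
  with it. Hence \<open>h\<close> is arbitrary in the induction, and dependence matters only on
  summands with smaller index. Splitting these into \<open>V\<close> (independent of
  \<open>\<xi> k\<close>) and \<open>U\<close> (the neighbours), union bounds control the events
  \<open>U \<noteq> 0\<close>.\<close>

lemma local_dependence_thinned_step:
  fixes \<xi> :: "nat \<Rightarrow> 'a \<Rightarrow> nat"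
  assumes indep: "\<And>k. k < m \<Longrightarrow>
      indep_var (count_space UNIV) (\<xi> k) (count_space UNIV) (\<lambda>\<omega>. \<Sum>i\<in>{..<k} - B k. \<xi> i \<omega>)"
    and bound: "\<And>k \<omega>. k < m \<Longrightarrow> \<omega> \<in> space M \<Longrightarrow> \<xi> k \<omega> \<le> J"
    and tail: "\<And>k j. k < m \<Longrightarrow> j < J \<Longrightarrow> prob {\<omega> \<in> space M. j < \<xi> k \<omega>} = p * \<rho> ^ j"
    and joint: "\<And>i k. i < k \<Longrightarrow> k < m \<Longrightarrow> i \<in> B k \<Longrightarrow> prob {\<omega> \<in> space M. \<xi> k \<omega> \<noteq> 0 \<and> \<xi> i \<omega> \<noteq> 0} \<le> \<epsilon>"
    and card: "\<And>k. k < m \<Longrightarrow> real (card ({..<k} \<inter> B k)) \<le> b"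
    and J: "0 < J" and \<rho>: "0 \<le> \<rho>" "\<rho> < 1" and p: "0 \<le> p" "p \<le> 1" and \<epsilon>: "0 \<le> \<epsilon>"
    and h: "unit_fun h"
  shows "\<bar>expectation (\<lambda>\<omega>. h (\<Sum>k<m. \<xi> k \<omega>)) - (thinned_step p \<rho> ^^ m) h 0\<bar>
    \<le> real m * (2 * b * \<epsilon> + 2 * b * p\<^sup>2 + p * \<rho> ^ J)"
proof -
  let ?e = "2 * b * \<epsilon> + 2 * b * p\<^sup>2 + p * \<rho> ^ J"
  have \<xi>: "\<xi> k \<in> measurable M (count_space UNIV)" if "k < m" for k
    using indep_var_rv1[OF indep[OF that]] .
  have pos: "prob {\<omega> \<in> space M. \<xi> k \<omega> \<noteq> 0} = p" if "k < m" for k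
    using tail[OF that J] by simp
  have ev: "{\<omega> \<in> space M. \<xi> k \<omega> \<noteq> 0} \<in> events" if "k < m" for k
    using \<xi>[OF that] by measurable
  have "\<bar>expectation (\<lambda>\<omega>. h (\<Sum>k<m'. \<xi> k \<omega>)) - (thinned_step p \<rho> ^^ m') h 0\<bar> \<le> real m' * ?e"
    if "m' \<le> m" for m'
    using that h
  proof (induction m' arbitrary: h)
    case (Suc k)
    hence k: "k < m" by simp
    let ?I = "{..<k} \<inter> B k"
    let ?V = "\<lambda>\<omega>. \<Sum>i\<in>{..<k} - B k. \<xi> i \<omega>" and ?U = "\<lambda>\<omega>. \<Sum>i\<in>?I. \<xi> i \<omega>"
    have VU: "?V \<omega> + ?U \<omega> = (\<Sum>i<k. \<xi> i \<omega>)" for \<omega>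
      by (subst sum.Int_Diff[of "{..<k}" _ "B k"]) auto
    have "{\<omega> \<in> space M. \<xi> k \<omega> \<noteq> 0 \<and> ?U \<omega> \<noteq> 0} = (\<Union>i\<in>?I. {\<omega> \<in> space M. \<xi> k \<omega> \<noteq> 0 \<and> \<xi> i \<omega> \<noteq> 0})"
      by auto
    also have "prob \<dots> \<le> (\<Sum>i\<in>?I. prob {\<omega> \<in> space M. \<xi> k \<omega> \<noteq> 0 \<and> \<xi> i \<omega> \<noteq> 0})"
    proof (rule finite_measure_subadditive_finite)
      have "{\<omega> \<in> space M. \<xi> k \<omega> \<noteq> 0 \<and> \<xi> i \<omega> \<noteq> 0} \<in> events" if "i < k" for i
        using sets.Int[OF ev[OF k] ev[of i]] that k by (auto simp: Int_def conj_commute conj_left_commute)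
      thus "(\<lambda>i. {\<omega> \<in> space M. \<xi> k \<omega> \<noteq> 0 \<and> \<xi> i \<omega> \<noteq> 0}) ` ?I \<subseteq> events" by auto
    qed auto
    also have "\<dots> \<le> real (card ?I) * \<epsilon>"
      using joint k by (intro sum_bounded_above) auto
    also have "\<dots> \<le> b * \<epsilon>" using card[OF k] \<epsilon> by (rule mult_right_mono)
    finally have 1: "prob {\<omega> \<in> space M. \<xi> k \<omega> \<noteq> 0 \<and> ?U \<omega> \<noteq> 0} \<le> b * \<epsilon>" .
    have "{\<omega> \<in> space M. ?U \<omega> \<noteq> 0} = (\<Union>i\<in>?I. {\<omega> \<in> space M. \<xi> i \<omega> \<noteq> 0})"
      by auto
    also have "prob \<dots> \<le> (\<Sum>i\<in>?I. prob {\<omega> \<in> space M. \<xi> i \<omega> \<noteq> 0})"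
      using ev k by (intro finite_measure_subadditive_finite) auto
    also have "\<dots> = real (card ?I) * p"
      using pos k by simp
    also have "\<dots> \<le> b * p" using card[OF k] p(1) by (rule mult_right_mono)
    finally have 2: "p * prob {\<omega> \<in> space M. ?U \<omega> \<noteq> 0} \<le> b * p\<^sup>2"
      using mult_left_mono[OF _ p(1)] by (fastforce simp: power2_eq_square algebra_simps)
    have "?U \<in> measurable M (count_space UNIV)"
      using \<xi> k by (intro measurable_sum_nat) auto
    hence "\<bar>expectation (\<lambda>\<omega>. h (?V \<omega> + ?U \<omega> + \<xi> k \<omega>)) - expectation (\<lambda>\<omega>. thinned_step p \<rho> h (?V \<omega> + ?U \<omega>))\<bar>
      \<le> 2 * prob {\<omega> \<in> space M. \<xi> k \<omega> \<noteq> 0 \<and> ?U \<omega> \<noteq> 0} + 2 * p * prob {\<omega> \<in> space M. ?U \<omega> \<noteq> 0} + p * \<rho> ^ J"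
      using bound tail k Suc.prems p \<rho> by (intro thinned_step_replacement indep) auto
    hence "\<bar>expectation (\<lambda>\<omega>. h (\<Sum>i<Suc k. \<xi> i \<omega>)) - expectation (\<lambda>\<omega>. thinned_step p \<rho> h (\<Sum>i<k. \<xi> i \<omega>))\<bar> \<le> ?e"
      using 1 2 unfolding VU by simp
    moreover have "\<bar>expectation (\<lambda>\<omega>. thinned_step p \<rho> h (\<Sum>i<k. \<xi> i \<omega>)) - (thinned_step p \<rho> ^^ k) (thinned_step p \<rho> h) 0\<bar>
      \<le> real k * ?e"
      using Suc.prems p \<rho> by (intro Suc.IH unit_fun_thinned_step) auto
    ultimately show ?case by (simp add: funpow_swap1 algebra_simps)
  qed (simp add: prob_space)
  thus ?thesis by simp
qed

end

section \<open>The law of a Poisson sum of geometric variables\<close>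

context prob_space
begin

lemma expectation_geometric:
  fixes Z V :: "'a \<Rightarrow> nat"
  assumes indep: "indep_var (count_space UNIV) Z (count_space UNIV) V"
    and Z: "\<And>k. 1 \<le> k \<Longrightarrow> prob {x \<in> space M. Z x = k} = (1 - \<rho>) * \<rho> ^ (k - 1)"
    and \<rho>: "0 \<le> \<rho>" "\<rho> < 1" and g: "unit_fun g"
  shows "expectation (\<lambda>x. g (V x + Z x)) = expectation (\<lambda>x. geom_mean \<rho> g (V x))"
proof -
  have V: "V \<in> measurable M (count_space UNIV)" and Zm: "Z \<in> measurable M (count_space UNIV)"
    using indep_var_rv1[OF indep] indep_var_rv2[OF indep] by auto
  let ?E = "\<lambda>j. {x \<in> space M. Z x = Suc j}"
  have ev: "?E j \<in> events" for j using Zm by measurable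
  \<comment> \<open>The probabilities of the values 1, 2, ... already sum to 1, so \<open>Z\<close>
    is almost surely positive.\<close>
  have sums: "(\<lambda>j. prob (?E j)) sums 1"
    using suminf_geom[OF \<rho>] Z \<rho> by (auto simp: sums_iff intro!: summable_mult summable_geometric)
  have "(\<lambda>j. prob (?E j)) sums prob (\<Union>j. ?E j)"
    using ev by (intro finite_measure_UNION) (auto simp: disjoint_family_on_def)
  hence "prob (\<Union>j. ?E j) = 1" using sums by (rule sums_unique2)
  hence AE: "AE x in M. x \<in> (\<Union>j. ?E j)"
    using ev by (intro AE_in_set_eq_1[THEN iffD2]) auto
  have meas: "(\<lambda>x. f (V x) (Z x)) \<in> borel_measurable M" for f :: "nat \<Rightarrow> nat \<Rightarrow> real"
    by (rule measurable_nat_fun2[OF V Zm]) simp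
  have gi: "integrable M (\<lambda>x. g (V x + Suc j))" for j
    using meas[of "\<lambda>v z. g (v + Suc j)"] g
    by (intro integrable_const_bound[where B = 1]) (auto simp: unit_fun_def)
  have term_int: "integrable M (\<lambda>x. indicator (?E j) x * g (V x + Suc j))" for j
    using integrable_mult_indicator[OF ev gi, of j j] by simp
  have E_term: "expectation (\<lambda>x. indicator (?E j) x * g (V x + Suc j))
      = (1 - \<rho>) * \<rho> ^ j * expectation (\<lambda>x. g (V x + Suc j))" for j
  proof -
    have "indep_var borel ((\<lambda>z. of_bool (z = Suc j) :: real) \<circ> Z) borel ((\<lambda>v. g (v + Suc j)) \<circ> V)"
      by (rule indep_var_compose[OF indep]) auto
    hence "expectation (\<lambda>x. of_bool (Z x = Suc j) * g (V x + Suc j))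
        = expectation (\<lambda>x. of_bool (Z x = Suc j)) * expectation (\<lambda>x. g (V x + Suc j))"
      using gi[of j] meas[of "\<lambda>v z. of_bool (z = Suc j)"]
      by (subst indep_var_lebesgue_integral[symmetric])
         (auto simp: o_def intro!: integrable_const_bound[where B = 1])
    also have "expectation (\<lambda>x. of_bool (Z x = Suc j)) = expectation (indicator (?E j))"
      by (intro Bochner_Integration.integral_cong) (auto simp: indicator_def)
    also have "\<dots> = (1 - \<rho>) * \<rho> ^ j"
      using Z[of "Suc j"] by (simp add: Int_absorb2[OF Collect_restrict])
    also have "expectation (\<lambda>x. of_bool (Z x = Suc j) * g (V x + Suc j))
        = expectation (\<lambda>x. indicator (?E j) x * g (V x + Suc j))"
      by (intro Bochner_Integration.integral_cong) (auto simp: indicator_def)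
    finally show ?thesis .
  qed
  have summ_bound: "norm (expectation (\<lambda>x. g (V x + Suc j))) \<le> 1" for j
  proof -
    have "\<bar>expectation (\<lambda>x. g (V x + Suc j))\<bar> \<le> expectation (\<lambda>x. \<bar>g (V x + Suc j)\<bar>)"
      by (rule integral_abs_bound)
    also have "\<dots> \<le> expectation (\<lambda>x. 1)"
      using gi g by (intro integral_mono) (auto simp: unit_fun_def)
    finally show ?thesis by (simp add: prob_space)
  qed
  \<comment> \<open>Partition by the value of \<open>Z\<close>, exchange sum and expectation, factor
    each term by independence, and exchange back.\<close>
  have "expectation (\<lambda>x. g (V x + Z x)) = expectation (\<lambda>x. \<Sum>j. indicator (?E j) x * g (V x + Suc j))"
  proof (intro integral_cong_AE)
    show "AE x in M. g (V x + Z x) = (\<Sum>j. indicator (?E j) x * g (V x + Suc j))"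
      using AE
    proof (eventually_elim)
      case (elim x)
      then obtain j where j: "Z x = Suc j" "x \<in> space M" by auto
      have "(\<Sum>i. indicator (?E i) x * g (V x + Suc i)) = (\<Sum>i\<in>{j}. indicator (?E i) x * g (V x + Suc i))"
        using j by (intro suminf_finite) auto
      thus ?case using j by simp
    qed
    show "(\<lambda>x. \<Sum>j. indicator (?E j) x * g (V x + Suc j)) \<in> borel_measurable M"
      using term_int by (intro borel_measurable_suminf) auto
  qed (rule meas)
  also have "\<dots> = (\<Sum>j. expectation (\<lambda>x. indicator (?E j) x * g (V x + Suc j)))"
  proof (rule integral_suminf[OF term_int])
    show "AE x in M. summable (\<lambda>j. norm (indicator (?E j) x * g (V x + Suc j)))"
    proof (rule AE_I2)
      fix x
      show "summable (\<lambda>j. norm (indicator (?E j) x * g (V x + Suc j)))"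
        by (rule summable_finite[of "{Z x - 1}"]) (auto simp: indicator_def)
    qed
    show "summable (\<lambda>j. expectation (\<lambda>x. norm (indicator (?E j) x * g (V x + Suc j))))"
    proof -
      have "norm (indicator (?E j) x * g (V x + Suc j)) = indicator (?E j) x * g (V x + Suc j)" for j x
        using g by (auto simp: unit_fun_def)
      moreover have "summable (\<lambda>j. (1 - \<rho>) * \<rho> ^ j * expectation (\<lambda>x. g (V x + Suc j)))"
      proof (rule summable_comparison_test')
        show "summable (\<lambda>j. (1 - \<rho>) * \<rho> ^ j)"
          using \<rho> by (intro summable_mult summable_geometric) auto
        show "norm ((1 - \<rho>) * \<rho> ^ j * expectation (\<lambda>x. g (V x + Suc j))) \<le> (1 - \<rho>) * \<rho> ^ j" for j
          using summ_bound[of j] \<rho> by (simp add: abs_mult mult_left_le)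
      qed
      ultimately show ?thesis by (simp only: E_term)
    qed
  qed
  also have "\<dots> = (\<Sum>j. expectation (\<lambda>x. (1 - \<rho>) * \<rho> ^ j * g (V x + Suc j)))"
    by (simp only: E_term integral_mult_right_zero)
  also have "\<dots> = expectation (\<lambda>x. \<Sum>j. (1 - \<rho>) * \<rho> ^ j * g (V x + Suc j))"
  proof (rule integral_suminf[symmetric])
    show "integrable M (\<lambda>x. (1 - \<rho>) * \<rho> ^ j * g (V x + Suc j))" for j
      using gi by simp
    have le: "norm ((1 - \<rho>) * \<rho> ^ j * g v) \<le> (1 - \<rho>) * \<rho> ^ j" for j v
      using g \<rho> by (auto simp: abs_mult mult_left_le unit_fun_def)
    have geom: "summable (\<lambda>j. (1 - \<rho>) * \<rho> ^ j)"
      using \<rho> by (intro summable_mult summable_geometric) auto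
    show "AE x in M. summable (\<lambda>j. norm ((1 - \<rho>) * \<rho> ^ j * g (V x + Suc j)))"
      by (intro AE_I2 summable_comparison_test'[OF geom]) (use le in auto)
    show "summable (\<lambda>j. expectation (\<lambda>x. norm ((1 - \<rho>) * \<rho> ^ j * g (V x + Suc j))))"
    proof (rule summable_comparison_test'[OF geom])
      fix j
      have "expectation (\<lambda>x. norm ((1 - \<rho>) * \<rho> ^ j * g (V x + Suc j))) \<le> expectation (\<lambda>x. (1 - \<rho>) * \<rho> ^ j)"
        using gi[of j] le by (intro integral_mono integrable_norm) auto
      thus "norm (expectation (\<lambda>x. norm ((1 - \<rho>) * \<rho> ^ j * g (V x + Suc j)))) \<le> (1 - \<rho>) * \<rho> ^ j"
        by (simp add: prob_space)
    qed
  qed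
  finally show ?thesis by (simp add: geom_mean_def)
qed

text \<open>Averaging out the last variable turns \<open>g\<close> into
  \<open>geom_mean \<rho> g\<close>; hence the induction over arbitrary \<open>g\<close>.\<close>

lemma expectation_geometric_sum:
  fixes \<zeta> :: "nat \<Rightarrow> 'a \<Rightarrow> nat"
  assumes indep: "indep_vars (\<lambda>_. count_space UNIV) \<zeta> {1..m}"
    and \<zeta>: "\<And>i k. 1 \<le> i \<Longrightarrow> i \<le> m \<Longrightarrow> 1 \<le> k \<Longrightarrow> prob {x \<in> space M. \<zeta> i x = k} = (1 - \<rho>) * \<rho> ^ (k - 1)"
    and \<rho>: "0 \<le> \<rho>" "\<rho> < 1" and g: "unit_fun g"
  shows "expectation (\<lambda>x. g (\<Sum>i=1..m. \<zeta> i x)) = (geom_mean \<rho> ^^ m) g 0"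
proof -
  have "expectation (\<lambda>x. g (\<Sum>i=1..j. \<zeta> i x)) = (geom_mean \<rho> ^^ j) g 0" if "j \<le> m" for j
    using that g
  proof (induction j arbitrary: g)
    case (Suc j)
    let ?I = "{1..j}"
    have sub: "indep_vars (\<lambda>_. count_space UNIV) \<zeta> (insert (Suc j) ?I)"
      by (rule indep_vars_subset[OF indep]) (use Suc.prems in auto)
    have "indep_var (count_space UNIV) ((\<lambda>f. f (Suc j)) \<circ> (\<lambda>x. restrict (\<lambda>i. \<zeta> i x) {Suc j}))
        (count_space UNIV) ((\<lambda>f. \<Sum>i\<in>?I. f i) \<circ> (\<lambda>x. restrict (\<lambda>i. \<zeta> i x) ?I))"
      by (intro indep_var_compose[OF indep_var_restrict[OF sub]] measurable_component_singleton measurable_sum_nat)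
         auto
    hence "indep_var (count_space UNIV) (\<zeta> (Suc j)) (count_space UNIV) (\<lambda>x. \<Sum>i=1..j. \<zeta> i x)"
      by (simp add: o_def)
    from expectation_geometric[OF this \<zeta> \<rho>]
    have "expectation (\<lambda>x. g (\<Sum>i=1..Suc j. \<zeta> i x)) = expectation (\<lambda>x. geom_mean \<rho> g (\<Sum>i=1..j. \<zeta> i x))"
      using Suc.prems by simp
    also have "\<dots> = (geom_mean \<rho> ^^ j) (geom_mean \<rho> g) 0"
      using Suc.prems \<rho> by (intro Suc.IH unit_fun_geom_mean) auto
    finally show ?case by (simp add: funpow_swap1)
  qed (simp add: prob_space)
  thus ?thesis by simp
qed

end

text \<open>Partition by the value \<open>m\<close> of \<open>W\<close>: by independence each part
  contributes a Poisson weight times the law of a sum of \<open>m\<close> geometric variables, and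
  these weights are the terms of \<open>poisson_mean\<close>.\<close>

lemma poisson_geometric_prob:
  assumes pg: "poisson_geometric M \<theta> \<rho> W \<zeta>" and \<rho>: "0 \<le> \<rho>" "\<rho> < 1" and \<theta>: "0 < \<theta>"
  shows "\<P>(x in M. (\<Sum>k=1..W x. \<zeta> k x) \<in> L)
    = poisson_mean (\<lambda>m. (geom_mean \<rho> ^^ m) (indicator L) 0) \<theta> 0"
proof -
  interpret prob_space M using pg by (simp add: poisson_geometric_def)
  let ?X = "\<lambda>j. if j = 0 then W else \<zeta> j"
  have indep: "indep_vars (\<lambda>_. count_space UNIV) ?X UNIV"
    and W: "distr M (count_space UNIV) W = measure_pmf (poisson_pmf \<theta>)"
    and \<zeta>: "\<And>j k. 1 \<le> j \<Longrightarrow> 1 \<le> k \<Longrightarrow> prob {x \<in> space M. \<zeta> j x = k} = (1 - \<rho>) * \<rho> ^ (k - 1)"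
    using pg by (auto simp: poisson_geometric_def)
  have Xm: "?X j \<in> measurable M (count_space UNIV)" for j
    using indep by (simp add: indep_vars_def)
  have Wm: "W \<in> measurable M (count_space UNIV)" using Xm[of 0] by simp
  have \<zeta>m: "\<zeta> j \<in> measurable M (count_space UNIV)" if "1 \<le> j" for j
    using Xm[of j] that by simp
  have u: "unit_fun (indicator L)" by (auto simp: unit_fun_def indicator_def)
  let ?T = "\<lambda>m x. \<Sum>k=1..m. \<zeta> k x"
  have Tm: "?T m \<in> measurable M (count_space UNIV)" for m
    using \<zeta>m by (intro measurable_sum_nat) auto
  let ?E = "\<lambda>m. {x \<in> space M. W x = m \<and> ?T m x \<in> L}"
  have ev: "?E m \<in> events" for m using Wm Tm[of m] by measurable
  have E: "prob (?E m) = exp (- \<theta>) * ((geom_mean \<rho> ^^ m) (indicator L) 0 / fact m * \<theta> ^ m)" for m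
  proof -
    \<comment> \<open>Slot 0 of the joint family holds \<open>W\<close>, so the disjoint index sets
      \<open>{0}\<close> and \<open>{1..m}\<close> make \<open>W\<close> independent of the
      sum.\<close>
    have "indep_var (count_space UNIV) ((\<lambda>f. f 0) \<circ> (\<lambda>x. restrict (\<lambda>i. ?X i x) {0}))
        (count_space UNIV) ((\<lambda>f. \<Sum>i\<in>{1..m}. f i) \<circ> (\<lambda>x. restrict (\<lambda>i. ?X i x) {1..m}))"
      by (intro indep_var_compose[OF indep_var_restrict[OF indep]] measurable_component_singleton measurable_sum_nat)
         auto
    hence "indep_var (count_space UNIV) W (count_space UNIV) (?T m)"
      by (simp add: o_def)
    hence "prob ((\<lambda>x. (W x, ?T m x)) -` ({m} \<times> L) \<inter> space M)
        = prob (W -` {m} \<inter> space M) * prob (?T m -` L \<inter> space M)"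
      by (rule indep_varD) auto
    also have "(\<lambda>x. (W x, ?T m x)) -` ({m} \<times> L) \<inter> space M = ?E m" by auto
    also have "prob (W -` {m} \<inter> space M) = measure (distr M (count_space UNIV) W) {m}"
      using Wm by (simp add: measure_distr)
    also have "\<dots> = \<theta> ^ m / fact m * exp (- \<theta>)"
      unfolding W using \<theta> by (simp add: measure_pmf_single)
    also have "prob (?T m -` L \<inter> space M) = expectation (\<lambda>x. indicator L (?T m x))"
    proof -
      have "expectation (\<lambda>x. indicator L (?T m x) :: real) = expectation (indicator (?T m -` L \<inter> space M))"
        by (intro Bochner_Integration.integral_cong) (auto simp: indicator_def)
      thus ?thesis by (simp add: Int_assoc)
    qed
    also have "\<dots> = (geom_mean \<rho> ^^ m) (indicator L) 0"
    proof (rule expectation_geometric_sum[OF _ \<zeta> \<rho> u])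
      have "indep_vars (\<lambda>_. count_space UNIV) ?X {1..m}"
        by (rule indep_vars_subset[OF indep]) auto
      thus "indep_vars (\<lambda>_. count_space UNIV) \<zeta> {1..m}"
        by (subst indep_vars_cong[where Y = ?X and J = "{1..m}" and N' = "\<lambda>_. count_space UNIV"]) auto
    qed
    finally show ?thesis by simp
  qed
  have "(\<lambda>m. prob (?E m)) sums prob (\<Union>m. ?E m)"
    using ev by (intro finite_measure_UNION) (auto simp: disjoint_family_on_def)
  also have "(\<Union>m. ?E m) = {x \<in> space M. (\<Sum>k=1..W x. \<zeta> k x) \<in> L}" by auto
  finally have "prob {x \<in> space M. (\<Sum>k=1..W x. \<zeta> k x) \<in> L} = (\<Sum>m. prob (?E m))"
    by (simp add: sums_iff)
  also have "\<dots> = poisson_mean (\<lambda>m. (geom_mean \<rho> ^^ m) (indicator L) 0) \<theta> 0"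
  proof -
    have "unit_fun (\<lambda>m. (geom_mean \<rho> ^^ m) (indicator L) 0)"
      using unit_fun_geom_mean_pow[OF \<rho> u] by (auto simp: unit_fun_def)
    from suminf_mult[OF summable_poisson_mean[OF this, of 0 \<theta>], of "exp (- \<theta>)"]
    show ?thesis unfolding E poisson_mean_def by simp
  qed
  finally show ?thesis .
qed

section \<open>Periods of words and clumps\<close>

lemma funpow_shift: "(shift ^^ m) \<omega> = (\<lambda>i. \<omega> (m + i))"
  by (induction m arbitrary: \<omega>) (auto simp: shift_def fun_eq_iff)

text \<open>Every \<open>e\<close> not less than the length of the word is vacuously a period, in
  accordance with the fact that disjoint copies of a word never conflict.\<close>

definition is_period :: "'a list \<Rightarrow> nat \<Rightarrow> bool" where
  "is_period a e \<longleftrightarrow> (\<forall>i. i + e < length a \<longrightarrow> a ! (i + e) = a ! i)"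

lemma cylinder_meets_shift_iff:
  "cylinder a \<inter> (shift ^^ e) -` cylinder a \<noteq> {} \<longleftrightarrow> is_period a e"
proof
  assume "cylinder a \<inter> (shift ^^ e) -` cylinder a \<noteq> {}"
  then obtain \<omega> where "\<forall>i<length a. \<omega> i = a ! i" "\<forall>i<length a. \<omega> (e + i) = a ! i"
    by (auto simp: cylinder_def funpow_shift)
  thus "is_period a e" by (auto simp: is_period_def add.commute[of _ e])
next
  assume per: "is_period a e"
  \<comment> \<open>Past the first copy of the word, the letters of the second copy, placed at
    \<open>e\<close>, are used; on the overlap the copies agree by periodicity. A gap between them
    receives \<open>a ! 0\<close> through truncated subtraction, which violates neither
    copy.\<close>
  define \<omega> where "\<omega> i = (if i < length a then a ! i else a ! (i - e))" for i
  have "\<omega> \<in> cylinder a \<inter> (shift ^^ e) -` cylinder a"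
    using per by (auto simp: cylinder_def funpow_shift \<omega>_def is_period_def add.commute)
  thus "cylinder a \<inter> (shift ^^ e) -` cylinder a \<noteq> {}" by blast
qed

lemma return_time_period:
  assumes "a \<noteq> []"
  defines "r \<equiv> return_time (length a) (cylinder a)"
  shows "1 \<le> r" "is_period a r" "\<And>e. 1 \<le> e \<Longrightarrow> is_period a e \<Longrightarrow> r \<le> e"
proof -
  let ?K = "{k \<in> {1..length a}. is_period a k}"
  have r: "r = Min ?K" by (simp add: r_def return_time_def cylinder_meets_shift_iff)
  have len: "length a \<in> ?K" using assms by (cases a) (auto simp: is_period_def)
  hence "Min ?K \<in> ?K" by (intro Min_in) auto
  thus "1 \<le> r" "is_period a r" by (auto simp: r)
  fix e assume e: "1 \<le> e" "is_period a e"
  show "r \<le> e"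
  proof (cases "e \<le> length a")
    case True
    with e show ?thesis unfolding r by (intro Min_le) auto
  next
    case False
    moreover have "r \<le> length a" unfolding r using len by (intro Min_le) auto
    ultimately show ?thesis by simp
  qed
qed

lemma is_period_mult:
  assumes "is_period a r" "i + r * m < length a"
  shows "a ! (i + r * m) = a ! i"
  using assms(2)
proof (induction m)
  case (Suc m)
  have "i + r * m + r < length a" using Suc.prems by (simp add: algebra_simps)
  hence "a ! (i + r * m + r) = a ! (i + r * m)"
    using assms(1) unfolding is_period_def by blast
  with Suc show ?case by (simp add: algebra_simps)
qed simp

lemma is_period_mod:
  assumes "is_period a r" "i < length a"
  shows "a ! (i mod r) = a ! i"
  using is_period_mult[of a r "i mod r" "i div r"] assms by simp

text \<open>A weak form of the theorem of Fine and Wilf, which suffices because one of the two periods is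
  the least one.\<close>

lemma least_period_dvd:
  assumes per: "is_period a r" "1 \<le> r" "is_period a e"
    and least: "\<And>s. 1 \<le> s \<Longrightarrow> is_period a s \<Longrightarrow> r \<le> s"
    and le: "2 * e \<le> length a"
  shows "r dvd e"
proof (rule ccontr)
  assume "\<not> r dvd e"
  hence pos: "1 \<le> e mod r" by (simp add: dvd_eq_mod_eq_0)
  have "is_period a (e mod r)"
    unfolding is_period_def
  proof (intro allI impI)
    fix i assume i: "i + e mod r < length a"
    let ?c = "r * (e div r)"
    have e: "e = ?c + e mod r" by simp
    \<comment> \<open>The shift by \<open>e mod r\<close> is a move by \<open>e\<close> forward and
      by \<open>?c\<close> back. If the forward move leaves the word, the backward move goes first;
      \<open>2 * e \<le> length a\<close> ensures that there is room for it.\<close>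
    show "a ! (i + e mod r) = a ! i"
    proof (cases "i + e < length a")
      case True
      have "a ! (i + e) = a ! i" using per(3) True by (simp add: is_period_def)
      moreover have "i + e = i + e mod r + ?c" by (simp add: algebra_simps)
      ultimately show ?thesis using is_period_mult[OF per(1), of "i + e mod r" "e div r"] True by simp
    next
      case False
      hence c: "?c \<le> i" using le e by linarith
      have "i - ?c + e < length a" using c i e by linarith
      hence "a ! (i - ?c + e) = a ! (i - ?c)"
        using per(3) unfolding is_period_def by blast
      moreover have "a ! (i - ?c + ?c) = a ! (i - ?c)"
        using c i by (intro is_period_mult[OF per(1)]) auto
      moreover have "i - ?c + e = i + e mod r" using c e by linarith
      ultimately show ?thesis using c by simp
    qed
  qed
  from least[OF pos this] show False using mod_less_divisor[of r e] per(2) by linarith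
qed

section \<open>The step \<open>kappa\<close> and periodic cylinders\<close>

lemma dvd_mult_iff_div_gcd_dvd:
  fixes r x e :: nat
  assumes "0 < r"
  shows "r dvd x * e \<longleftrightarrow> r div gcd r x dvd e"
proof -
  let ?g = "gcd r x"
  have r: "r div ?g * ?g = r" and x: "x div ?g * ?g = x" by simp_all
  have "x div ?g * e * ?g = x div ?g * ?g * e" by (simp only: mult.assoc mult.commute[of e])
  hence xe: "x div ?g * e * ?g = x * e" unfolding x .
  have "r dvd x * e \<longleftrightarrow> r div ?g * ?g dvd x div ?g * e * ?g" unfolding r xe ..
  also have "\<dots> \<longleftrightarrow> r div ?g dvd (x div ?g) * e"
    using assms by (intro dvd_times_right_cancel_iff) auto
  also have "\<dots> \<longleftrightarrow> r div ?g dvd e"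
    using assms by (intro coprime_dvd_mult_right_iff div_gcd_coprime) auto
  finally show ?thesis .
qed

text \<open>This is the role of \<open>kappa\<close>: its multiples are exactly the displacements of
  \<open>k\<close> that move every block by a multiple of \<open>r\<close>, keeping all factors in
  phase with the period.\<close>

lemma kappa_dvd_iff:
  assumes "0 < r"
  shows "kappa l d r dvd e \<longleftrightarrow> (\<forall>i\<in>{1..l}. r dvd d i * e)"
proof -
  have "{r div gcd r (d i) |i. i \<in> {1..l}} = (\<lambda>i. r div gcd r (d i)) ` {1..l}" by blast
  thus ?thesis by (simp add: kappa_def Lcm_dvd_iff dvd_mult_iff_div_gcd_dvd[OF assms])
qed

lemma kappa_bounds:
  assumes "0 < r"
  shows "1 \<le> kappa l d r" "kappa l d r \<le> r"
proof -
  have "kappa l d r dvd r" using assms by (subst kappa_dvd_iff) auto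
  thus "1 \<le> kappa l d r" "kappa l d r \<le> r"
    using assms by (auto dest: dvd_imp_le dvd_pos_nat simp: Suc_le_eq)
qed

lemma periodic_cylinder_iff:
  assumes "0 < r" "length b = r"
  shows "\<omega> \<in> periodic_cylinder b m \<longleftrightarrow> (\<forall>u<m. \<omega> u = b ! (u mod r))"
proof -
  have "\<omega> \<in> periodic_cylinder b m \<longleftrightarrow>
      (\<forall>k<m div r. \<forall>i<r. \<omega> (k * r + i) = b ! i) \<and> (\<forall>i<m mod r. \<omega> (r * (m div r) + i) = b ! i)"
  proof -
    have "m - r * (m div r) = m mod r" by (simp add: minus_mult_div_eq_mod)
    moreover have "m mod r < r" using assms by simp
    ultimately show ?thesis using assms
      unfolding periodic_cylinder_def Let_def by (auto simp: cylinder_def funpow_shift)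
  qed
  also have "\<dots> \<longleftrightarrow> (\<forall>u<m. \<omega> u = b ! (u mod r))"
  proof (intro iffI allI impI conjI)
    fix u assume *: "(\<forall>k<m div r. \<forall>i<r. \<omega> (k * r + i) = b ! i) \<and> (\<forall>i<m mod r. \<omega> (r * (m div r) + i) = b ! i)"
      and u: "u < m"
    have eq: "u = (u div r) * r + u mod r" by simp
    show "\<omega> u = b ! (u mod r)"
    proof (cases "u div r < m div r")
      case True
      thus ?thesis using *[THEN conjunct1, rule_format, of "u div r" "u mod r"] assms by simp
    next
      case False
      hence "m div r = u div r" using u by (simp add: div_le_mono le_antisym)
      hence u': "u = m div r * r + u mod r" using div_mult_mod_eq[of u r] by simp
      hence "u mod r < m mod r" using u div_mult_mod_eq[of m r] by linarith
      hence "\<omega> (r * (m div r) + u mod r) = b ! (u mod r)" using * by blast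
      thus ?thesis by (subst u') (simp only: mult.commute)
    qed
  next
    fix k i assume *: "\<forall>u<m. \<omega> u = b ! (u mod r)" and k: "k < m div r" "i < r"
    have "k * r + i < Suc k * r" using k by simp
    also have "\<dots> \<le> (m div r) * r" using k by (intro mult_right_mono) auto
    also have "\<dots> \<le> m" by simp
    finally show "\<omega> (k * r + i) = b ! i" using * k by simp
  next
    fix i assume *: "\<forall>u<m. \<omega> u = b ! (u mod r)" and i: "i < m mod r"
    have "r * (m div r) + i < m" using i mult_div_mod_eq[of r m] by linarith
    moreover have "i < r" using i mod_less_divisor[of r m] assms by linarith
    ultimately show "\<omega> (r * (m div r) + i) = b ! i" using * by simp
  qed
  finally show ?thesis .
qed

section \<open>Runs and clumps of a sequence of truth values\<close>

text \<open>The length of a run is cut off at \<open>n\<close>, so that a clump depends on finitely many values of \<open>x\<close>.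
  The truncated difference \<open>k - \<kappa>\<close> is harmless because \<open>clump\<close> is only used for \<open>\<kappa> \<le> k\<close>.\<close>

definition run :: "(nat \<Rightarrow> bool) \<Rightarrow> nat \<Rightarrow> nat \<Rightarrow> nat \<Rightarrow> bool" where
  "run x \<kappa> k j \<longleftrightarrow> (\<forall>m\<le>j. x (k + m * \<kappa>))"

definition run_length :: "(nat \<Rightarrow> bool) \<Rightarrow> nat \<Rightarrow> nat \<Rightarrow> nat \<Rightarrow> nat" where
  "run_length x \<kappa> n k = card {j. j < n \<and> run x \<kappa> k j}"

definition clump :: "(nat \<Rightarrow> bool) \<Rightarrow> nat \<Rightarrow> nat \<Rightarrow> nat \<Rightarrow> nat" where
  "clump x \<kappa> n k = (if x (k - \<kappa>) then 0 else run_length x \<kappa> n k)"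

lemma run_Suc: "run x \<kappa> k (Suc j) \<longleftrightarrow> x k \<and> run x \<kappa> (k + \<kappa>) j"
proof -
  have "run x \<kappa> k (Suc j) \<longleftrightarrow> (\<forall>m<Suc (Suc j). x (k + m * \<kappa>))"
    by (simp add: run_def less_Suc_eq_le)
  also have "\<dots> \<longleftrightarrow> x k \<and> (\<forall>m<Suc j. x (k + \<kappa> + m * \<kappa>))"
    by (subst All_less_Suc2) (simp add: algebra_simps)
  finally show ?thesis by (simp add: run_def less_Suc_eq_le)
qed

lemma run_0 [simp]: "run x \<kappa> k 0 \<longleftrightarrow> x k"
  by (simp add: run_def)

lemma run_first: "run x \<kappa> k j \<Longrightarrow> x k"
  by (cases j) (auto simp: run_Suc)

lemma run_length_le: "run_length x \<kappa> n k \<le> n"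
  unfolding run_length_def by (rule order.trans[OF card_mono[of "{..<n}"]]) auto

lemma clump_le: "clump x \<kappa> n k \<le> n"
  by (simp add: clump_def run_length_le)

text \<open>Runs are closed under shortening, so the set that is counted is an initial segment of
  the naturals.\<close>

lemma less_run_length_iff:
  assumes "j < n"
  shows "j < run_length x \<kappa> n k \<longleftrightarrow> run x \<kappa> k j"
proof
  assume "run x \<kappa> k j"
  hence "{..j} \<subseteq> {j. j < n \<and> run x \<kappa> k j}" using assms by (auto simp: run_def)
  from card_mono[OF _ this] show "j < run_length x \<kappa> n k" by (simp add: run_length_def)
next
  assume len: "j < run_length x \<kappa> n k"
  show "run x \<kappa> k j"
  proof (rule ccontr)
    assume "\<not> run x \<kappa> k j"
    hence "{j. j < n \<and> run x \<kappa> k j} \<subseteq> {..<j}" unfolding run_def by (force simp: not_le[symmetric])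
    from card_mono[OF _ this] len show False by (simp add: run_length_def)
  qed
qed

lemma less_clump_iff:
  assumes "j < n"
  shows "j < clump x \<kappa> n k \<longleftrightarrow> \<not> x (k - \<kappa>) \<and> run x \<kappa> k j"
  using less_run_length_iff[OF assms] by (simp add: clump_def)

lemma run_length_eq_0: "\<not> x k \<Longrightarrow> run_length x \<kappa> n k = 0"
  unfolding run_length_def by (auto dest: run_first)

text \<open>Excluding a run of \<open>n + 1\<close> places keeps the cap \<open>n\<close> from
  taking effect: with such a run both lengths would equal \<open>n\<close>.\<close>

lemma run_length_rec:
  assumes "x k" "\<not> run x \<kappa> k n" "0 < n"
  shows "run_length x \<kappa> n k = Suc (run_length x \<kappa> n (k + \<kappa>))"
proof -
  obtain n' where n: "n = Suc n'" using assms(3) by (cases n) auto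
  have "{j. j < n \<and> run x \<kappa> k j} = insert 0 (Suc ` {j. j < n \<and> run x \<kappa> (k + \<kappa>) j})"
  proof (intro equalityI subsetI)
    fix j assume "j \<in> {j. j < n \<and> run x \<kappa> k j}"
    thus "j \<in> insert 0 (Suc ` {j. j < n \<and> run x \<kappa> (k + \<kappa>) j})"
      by (cases j) (auto simp: run_Suc)
  next
    fix j assume j: "j \<in> insert 0 (Suc ` {j. j < n \<and> run x \<kappa> (k + \<kappa>) j})"
    show "j \<in> {j. j < n \<and> run x \<kappa> k j}"
    proof (cases j)
      case (Suc i)
      with j have i: "i < n" "run x \<kappa> (k + \<kappa>) i" by auto
      have "i \<noteq> n'" using i assms n by (auto simp: run_Suc)
      thus ?thesis using i Suc assms n by (auto simp: run_Suc)
    qed (use assms in auto)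
  qed
  thus ?thesis unfolding run_length_def by (simp add: card_image)
qed

text \<open>In the sum over \<open>k\<close> of the identity \<open>local\<close> the two terms with \<open>run_length\<close> cancel.\<close>

lemma sum_clump:
  assumes \<kappa>: "\<kappa> \<le> K" and n: "0 < n"
    and start: "\<And>k. K - \<kappa> < k \<Longrightarrow> k \<le> K \<Longrightarrow> \<not> x k"
    and stop: "\<And>k. N - \<kappa> < k \<Longrightarrow> k \<le> N \<Longrightarrow> \<not> x k"
    and long: "\<And>k. K < k \<Longrightarrow> k \<le> N \<Longrightarrow> \<not> run x \<kappa> k n"
  shows "(\<Sum>k\<in>{K<..N}. clump x \<kappa> n k) = (\<Sum>k\<in>{K<..N}. of_bool (x k))"
proof (cases "K \<le> N")
  case True
  let ?f = "run_length x \<kappa> n" and ?I = "{K - \<kappa><..N - \<kappa>}"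
  have local: "clump x \<kappa> n (k + \<kappa>) + ?f k = ?f (k + \<kappa>) + of_bool (x k)" if "k \<in> ?I" for k
  proof (cases "x k")
    case True
    hence "K < k" using start[of k] that by force
    hence "\<not> run x \<kappa> k n" using long that by auto
    thus ?thesis using True n by (simp add: clump_def run_length_rec)
  qed (simp add: clump_def run_length_eq_0)
  have shift: "(\<Sum>k\<in>?I. g (k + \<kappa>)) = (\<Sum>k\<in>{K<..N}. g k)" for g :: "nat \<Rightarrow> nat"
    by (rule sum.reindex_bij_witness[of _ "\<lambda>k. k - \<kappa>" "\<lambda>k. k + \<kappa>"]) (use \<kappa> True in auto)
  \<comment> \<open>The two index ranges differ only near the two ends, where \<open>start\<close>
    and \<open>stop\<close> say that \<open>x\<close> fails.\<close>
  have cut: "(\<Sum>k\<in>?I. g k) = (\<Sum>k\<in>{K<..N}. g k)" if "\<And>k. \<not> x k \<Longrightarrow> g k = 0" for g :: "nat \<Rightarrow> nat"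
  proof -
    have "(\<Sum>k\<in>?I. g k) = (\<Sum>k\<in>?I \<union> {K<..N}. g k)"
    proof (intro sum.mono_neutral_left ballI)
      fix k assume "k \<in> ?I \<union> {K<..N} - ?I"
      hence "\<not> x k" by (intro stop) auto
      thus "g k = 0" by (rule that)
    qed auto
    also have "\<dots> = (\<Sum>k\<in>{K<..N}. g k)"
    proof (intro sum.mono_neutral_right ballI)
      fix k assume "k \<in> ?I \<union> {K<..N} - {K<..N}"
      hence "\<not> x k" by (intro start) auto
      thus "g k = 0" by (rule that)
    qed auto
    finally show ?thesis .
  qed
  have "(\<Sum>k\<in>?I. clump x \<kappa> n (k + \<kappa>) + ?f k) = (\<Sum>k\<in>?I. ?f (k + \<kappa>) + of_bool (x k))"
    using local by (intro sum.cong) auto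
  hence "(\<Sum>k\<in>{K<..N}. clump x \<kappa> n k) + (\<Sum>k\<in>?I. ?f k)
      = (\<Sum>k\<in>{K<..N}. ?f k) + (\<Sum>k\<in>?I. of_bool (x k))"
    unfolding sum.distrib shift .
  moreover have "(\<Sum>k\<in>?I. ?f k) = (\<Sum>k\<in>{K<..N}. ?f k)"
    by (rule cut) (rule run_length_eq_0)
  moreover have "(\<Sum>k\<in>?I. of_bool (x k)) = (\<Sum>k\<in>{K<..N}. of_bool (x k) :: nat)"
    by (rule cut) simp
  ultimately show ?thesis by linarith
qed simp

section \<open>Independent identically distributed letters\<close>

locale iid_sequence = shift_probability P for P :: "(nat \<Rightarrow> 'a :: countable) measure" +
  assumes product_stationary: "product_stationary P"
begin

definition letter_prob :: "'a \<Rightarrow> real" where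
  "letter_prob x = prob {\<omega>. \<omega> 0 = x}"

lemma space_P [simp]: "space P = UNIV"
  using sets_eq_imp_space_eq[OF sets_P] by (simp add: space_PiM PiE_UNIV_domain)

lemma indep_coordinates: "indep_vars (\<lambda>_. count_space UNIV) (\<lambda>i \<omega>. \<omega> i) UNIV"
  using product_stationary by (simp add: product_stationary_def)

lemma coordinate_measurable [measurable]: "(\<lambda>\<omega>. \<omega> i) \<in> measurable P (count_space UNIV)"
  using indep_coordinates by (simp add: indep_vars_def)

lemma prob_coordinate: "prob {\<omega>. \<omega> i = x} = letter_prob x"
proof -
  have "measure (distr P (count_space UNIV) (\<lambda>\<omega>. \<omega> i)) {x} = measure (distr P (count_space UNIV) (\<lambda>\<omega>. \<omega> 0)) {x}"
    using product_stationary unfolding product_stationary_def by metis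
  thus ?thesis
    by (simp add: letter_prob_def measure_distr vimage_def)
qed

lemma letter_prob_nonneg: "0 \<le> letter_prob x"
  by (simp add: letter_prob_def)

text \<open>Conditions are indexed by an abstract set \<open>T\<close>, so that the blocks of
  several factors are treated at once; injectivity of \<open>c\<close> expresses that the blocks do
  not overlap.\<close>

lemma prob_letters:
  assumes "finite T" "inj_on c T"
  shows "prob {\<omega>. \<forall>t\<in>T. \<omega> (c t) = x t} = (\<Prod>t\<in>T. letter_prob (x t))"
proof (cases "T = {}")
  case False
  let ?y = "\<lambda>i. x (the_inv_into T c i)"
  have inv: "the_inv_into T c (c t) = t" if "t \<in> T" for t
    using the_inv_into_f_f[OF assms(2) that] .
  have "prob (\<Inter>i\<in>c ` T. (\<lambda>\<omega>. \<omega> i) -` {?y i} \<inter> space P) = (\<Prod>i\<in>c ` T. prob ((\<lambda>\<omega>. \<omega> i) -` {?y i} \<inter> space P))"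
    using False assms by (intro indep_varsD[OF indep_coordinates]) auto
  also have "(\<Inter>i\<in>c ` T. (\<lambda>\<omega>. \<omega> i) -` {?y i} \<inter> space P) = {\<omega>. \<forall>t\<in>T. \<omega> (c t) = x t}"
    using False by (auto simp: inv)
  also have "(\<Prod>i\<in>c ` T. prob ((\<lambda>\<omega>. \<omega> i) -` {?y i} \<inter> space P)) = (\<Prod>t\<in>T. letter_prob (x t))"
    using assms by (simp add: prod.reindex inv vimage_def prob_coordinate)
  finally show ?thesis .
qed (simp add: prob_space[simplified])

lemma letters_measurable:
  assumes "finite T"
  shows "{\<omega>. \<forall>t\<in>T. \<omega> (c t) = x t} \<in> events"
proof -
  have "{\<omega> \<in> space P. \<forall>t\<in>T. \<omega> (c t) = x t} \<in> events"
    using assms by measurable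
  thus ?thesis by simp
qed

lemma prob_cylinder: "prob (cylinder a) = (\<Prod>i<length a. letter_prob (a ! i))"
  using prob_letters[of "{..<length a}" "\<lambda>i. i" "\<lambda>i. a ! i"] by (simp add: cylinder_def Ball_def)

lemma letter_prob_eq_cylinder: "letter_prob x = prob (cylinder [x])"
  by (simp add: letter_prob_def cylinder_def)

text \<open>Both functions factor through restrictions to disjoint sets of coordinates. Over
  finitely many coordinates in a countable alphabet the product \<sigma>-algebra is discrete, so
  measurability of the factored functions is automatic.\<close>

lemma indep_finite_range:
  fixes F1 F2 :: "(nat \<Rightarrow> 'a) \<Rightarrow> nat"
  assumes "finite D1" "finite D2" "D1 \<inter> D2 = {}"
    and F1: "\<And>\<omega> \<omega>'. (\<And>i. i \<in> D1 \<Longrightarrow> \<omega> i = \<omega>' i) \<Longrightarrow> F1 \<omega> = F1 \<omega>'"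
    and F2: "\<And>\<omega> \<omega>'. (\<And>i. i \<in> D2 \<Longrightarrow> \<omega> i = \<omega>' i) \<Longrightarrow> F2 \<omega> = F2 \<omega>'"
  shows "indep_var (count_space UNIV) F1 (count_space UNIV) F2"
proof -
  have meas: "F \<in> measurable (PiM D (\<lambda>_. count_space UNIV)) (count_space UNIV)" if "finite D"
    for D and F :: "(nat \<Rightarrow> 'a) \<Rightarrow> nat"
    using that by (subst count_space_PiM_finite) auto
  have "indep_var (count_space UNIV) (F1 \<circ> (\<lambda>\<omega>. restrict (\<lambda>i. \<omega> i) D1))
      (count_space UNIV) (F2 \<circ> (\<lambda>\<omega>. restrict (\<lambda>i. \<omega> i) D2))"
    using assms by (intro indep_var_compose[OF indep_var_restrict[OF indep_coordinates]] meas) auto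
  moreover have "F1 \<circ> (\<lambda>\<omega>. restrict (\<lambda>i. \<omega> i) D1) = F1" "F2 \<circ> (\<lambda>\<omega>. restrict (\<lambda>i. \<omega> i) D2) = F2"
    by (auto simp: fun_eq_iff intro!: F1 F2)
  ultimately show ?thesis by simp
qed

lemma ex_cylinder_decay: "\<exists>\<Gamma>. cylinder_decay P \<Gamma>"
proof -
  obtain x y :: 'a where xy: "x \<noteq> y" using alphabet by blast
  \<comment> \<open>Every letter differs from \<open>x\<close> or from \<open>y\<close>, so its
    probability is at most the complement of that of \<open>x\<close> or of
    \<open>y\<close>.\<close>
  define q where "q = max (1 - letter_prob x) (1 - letter_prob y)"
  have le: "letter_prob z \<le> 1 - letter_prob w" if "z \<noteq> w" for z w
  proof -
    have "{\<omega>. \<omega> 0 = w} \<in> events"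
      using letters_measurable[of "{0::nat}" "\<lambda>i. i" "\<lambda>_. w"] by simp
    hence "1 - letter_prob w = prob (- {\<omega>. \<omega> 0 = w})"
      using prob_compl[of "{\<omega>. \<omega> 0 = w}"] by (simp add: letter_prob_def Compl_eq_Diff_UNIV)
    also have "letter_prob z \<le> \<dots>"
      unfolding letter_prob_def using that sets.compl_sets[OF \<open>{\<omega>. \<omega> 0 = w} \<in> events\<close>]
      by (intro finite_measure_mono) (auto simp: Compl_eq_Diff_UNIV)
    finally show ?thesis .
  qed
  have pos: "0 < letter_prob z" for z
    using cylinder_pos[of z] by (simp add: letter_prob_eq_cylinder)
  have z: "letter_prob z \<le> q" for z
    using le[of z x] le[of z y] xy by (cases "z = x") (auto simp: q_def)
  have q: "0 < q" "q < 1" using pos[of x] pos[of y] z[of x] by (auto simp: q_def)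
  have "cylinder_decay P (- ln q)"
    unfolding cylinder_decay_def cylinders_def
  proof (intro conjI allI impI ballI)
    show "0 < - ln q" using q by simp
    fix m :: nat and B assume "B \<in> {cylinder a |a :: 'a list. length a = m}"
    then obtain a :: "'a list" where a: "B = cylinder a" "length a = m" by blast
    have "prob B \<le> (\<Prod>i<m. q)"
      unfolding a prob_cylinder a(2) using z letter_prob_nonneg by (intro prod_mono) auto
    also have "\<dots> = exp (- (- ln q) * real m)"
      using q by (simp add: exp_of_nat_mult mult.commute)
    finally show "prob B \<le> exp (- (- ln q) * real m)" .
  qed
  thus ?thesis ..
qed

lemma letter_prob_le_exp:
  assumes "cylinder_decay P \<Gamma>"
  shows "letter_prob x \<le> exp (- \<Gamma>)"
proof -
  have "cylinder [x] \<in> cylinders 1" by (auto simp: cylinders_def)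
  hence "prob (cylinder [x]) \<le> exp (- \<Gamma> * real 1)"
    using assms unfolding cylinder_decay_def by blast
  thus ?thesis by (simp add: letter_prob_eq_cylinder)
qed

lemma prod_letter_prob_le:
  assumes "cylinder_decay P \<Gamma>"
  shows "(\<Prod>t\<in>T. letter_prob (x t)) \<le> exp (- \<Gamma>) ^ card T"
proof -
  have "(\<Prod>t\<in>T. letter_prob (x t)) \<le> (\<Prod>t\<in>T. exp (- \<Gamma>))"
    using letter_prob_le_exp[OF assms] letter_prob_nonneg by (intro prod_mono) auto
  thus ?thesis by simp
qed

end

section \<open>Occurrences of a periodic pattern\<close>

text \<open>Words of length \<open>n\<close> placed at \<open>0, D, ..., D * j\<close> cover an
  interval without gaps when \<open>D \<le> n\<close>. The witness is the last word that starts at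
  or before \<open>u\<close>.\<close>

lemma sub_mult_less_of_min_div:
  fixes u D j n :: nat
  assumes "u < n + D * j" "D \<le> n" "0 < D"
  obtains m where "m \<le> j" "D * m \<le> u" "u - D * m < n"
proof
  let ?m = "min j (u div D)"
  show "?m \<le> j" by simp
  have "D * ?m \<le> D * (u div D)" by (intro mult_left_mono) auto
  also have "\<dots> \<le> u" by simp
  finally show le: "D * ?m \<le> u" .
  show "u - D * ?m < n"
  proof (cases "j \<le> u div D")
    case True
    thus ?thesis using assms le by (simp add: min_def)
  next
    case False
    hence "u - D * ?m = u mod D" by (simp add: min_def minus_mult_div_eq_mod)
    also have "\<dots> < n" using mod_less_divisor[OF assms(3), of u] assms(2) by linarith
    finally show ?thesis .
  qed
qed

locale periodic_pattern = iid_sequence P for P :: "(nat \<Rightarrow> 'a :: countable) measure" +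
  fixes \<Gamma> :: real and l :: nat and d :: "nat \<Rightarrow> nat" and a :: "'a list"
  assumes decay: "cylinder_decay P \<Gamma>"
    and l: "1 \<le> l" and d1: "1 \<le> d 1" and d_mono: "strict_mono_on {1..l} d"
    and a_pos: "0 < prob (cylinder a)" and a_ne: "a \<noteq> []"
    and long: "return_time (length a) (cylinder a) * (d l + 6) < length a"
begin

abbreviation "n \<equiv> length a"

definition "r = return_time n (cylinder a)"

definition "\<kappa> = kappa l d r"

definition "p = prob (cylinder a)"

definition "\<rho> = rho P l d a"

definition occurs :: "(nat \<Rightarrow> 'a) \<Rightarrow> nat \<Rightarrow> bool" where
  "occurs \<omega> k \<longleftrightarrow> (\<forall>i\<in>{1..l}. \<forall>j<n. \<omega> (d i * k + j) = a ! j)"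

abbreviation "run_event k j \<equiv> {\<omega>. run (occurs \<omega>) \<kappa> k j}"

lemma d_le: "i \<in> {1..l} \<Longrightarrow> d i \<le> d l"
  using strict_mono_onD[OF d_mono, of i l] by (cases "i = l") auto

lemma d_less: "i \<in> {1..l} \<Longrightarrow> j \<in> {1..l} \<Longrightarrow> i < j \<Longrightarrow> d i < d j"
  using strict_mono_onD[OF d_mono] .

lemma d_pos: "i \<in> {1..l} \<Longrightarrow> 1 \<le> d i"
  using d_less[of 1 i] d1 l by (cases "i = 1") auto

lemma l_mem: "l \<in> {1..l}" "1 \<in> {1..l}"
  using l by auto

lemma r_pos: "1 \<le> r" and r_period: "is_period a r"
  and r_least: "1 \<le> e \<Longrightarrow> is_period a e \<Longrightarrow> r \<le> e"
  using return_time_period[OF a_ne] by (auto simp: r_def)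

lemma \<kappa>_bounds: "1 \<le> \<kappa>" "\<kappa> \<le> r"
  using kappa_bounds[of r l d] r_pos by (auto simp: \<kappa>_def)

lemma r_dvd: "i \<in> {1..l} \<Longrightarrow> r dvd d i * \<kappa>"
  using kappa_dvd_iff[of r l d \<kappa>] r_pos by (auto simp: \<kappa>_def)

lemma n_bounds: "d l * r < n" "6 * \<kappa> < n" "1 \<le> n"
proof -
  have "d l * r + 6 * r < n" using long unfolding r_def[symmetric] by (simp add: algebra_simps)
  thus "d l * r < n" "6 * \<kappa> < n" "1 \<le> n" using \<kappa>_bounds by linarith+
qed

text \<open>Consecutive words of a run thus leave no gap in any of the blocks; this is where the
  lower bound on \<open>n\<close> enters.\<close>

lemma d\<kappa>_le: "i \<in> {1..l} \<Longrightarrow> d i * \<kappa> \<le> n"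
  using mult_le_mono[OF d_le \<kappa>_bounds(2), of i] n_bounds(1) by simp

lemma d\<kappa>_pos: "i \<in> {1..l} \<Longrightarrow> 0 < d i * \<kappa>"
  using d_pos[of i] \<kappa>_bounds by simp

text \<open>\<open>d l * n\<^sup>2\<close> serves as a uniform bound for the reach of
  \<open>n\<close> steps of size \<open>\<kappa>\<close> followed by a word.\<close>

lemma window_le: "d l * n * \<kappa> + n \<le> d l * n\<^sup>2"
proof -
  have "1 \<le> d l" using d_pos[OF l_mem(1)] .
  have "d l * n * \<kappa> + n \<le> d l * n * \<kappa> + d l * n"
    using \<open>1 \<le> d l\<close> by simp
  also have "\<dots> = d l * n * (\<kappa> + 1)" by (simp add: algebra_simps)
  also have "\<dots> \<le> d l * n * n" using n_bounds by (intro mult_le_mono) auto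
  finally show ?thesis by (simp add: power2_eq_square)
qed

section \<open>The law of a run of occurrences\<close>

lemma X_eq: "X l d (cylinder a) k \<omega> = of_bool (occurs \<omega> k)"
proof -
  have "X l d (cylinder a) k \<omega> = (\<Prod>i=1..l. of_bool (\<forall>j<n. \<omega> (d i * k + j) = a ! j))"
    unfolding X_def by (intro prod.cong refl) (auto simp: indicator_def cylinder_def funpow_shift)
  thus ?thesis by (auto simp: occurs_def)
qed

text \<open>In factor \<open>i\<close> the words of a run overlap or abut, and their offsets
  \<open>d i * \<kappa> * m\<close> are multiples of \<open>r\<close>. They therefore merge into one
  \<open>r\<close>-periodic block, so no position of that block is conditioned twice.\<close>

lemma run_occurs_iff:
  "run (occurs \<omega>) \<kappa> k j \<longleftrightarrow>
    (\<forall>t\<in>Sigma {1..l} (\<lambda>i. {..<n + d i * \<kappa> * j}). \<omega> (d (fst t) * k + snd t) = a ! (snd t mod r))"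
  (is "?L \<longleftrightarrow> ?R")
proof
  assume L: ?L
  show ?R
  proof
    fix t assume "t \<in> Sigma {1..l} (\<lambda>i. {..<n + d i * \<kappa> * j})"
    then obtain i u where t: "t = (i, u)" and i: "i \<in> {1..l}" and u: "u < n + d i * \<kappa> * j" by auto
    obtain m where m: "m \<le> j" "d i * \<kappa> * m \<le> u" "u - d i * \<kappa> * m < n"
      using sub_mult_less_of_min_div[OF u d\<kappa>_le[OF i] d\<kappa>_pos[OF i]] .
    define v where "v = u - d i * \<kappa> * m"
    have u_eq: "u = d i * \<kappa> * m + v" using m by (simp add: v_def)
    have "occurs \<omega> (k + m * \<kappa>)" using L m(1) by (simp add: run_def)
    hence "\<omega> (d i * (k + m * \<kappa>) + v) = a ! v" using i m(3) by (simp add: occurs_def v_def)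
    also have "d i * (k + m * \<kappa>) + v = d i * k + u" unfolding u_eq by (simp add: algebra_simps)
    also have "a ! v = a ! (v mod r)" using m(3) by (intro is_period_mod[OF r_period, symmetric]) (simp add: v_def)
    also have "v mod r = u mod r"
      unfolding u_eq using r_dvd[OF i] by (simp add: mod_add_eq dvd_imp_mod_0 flip: mod_add_left_eq)
    finally show "\<omega> (d (fst t) * k + snd t) = a ! (snd t mod r)" by (simp add: t)
  qed
next
  assume R: ?R
  show ?L
    unfolding run_def occurs_def
  proof (intro allI impI ballI)
    fix m i v assume m: "m \<le> j" and i: "i \<in> {1..l}" and v: "v < n"
    have "d i * \<kappa> * m \<le> d i * \<kappa> * j" using m by (rule mult_left_mono) simp
    hence "d i * \<kappa> * m + v < n + d i * \<kappa> * j" using v by linarith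
    with i have "(i, d i * \<kappa> * m + v) \<in> Sigma {1..l} (\<lambda>i. {..<n + d i * \<kappa> * j})"
      unfolding mem_Sigma_iff lessThan_iff ..
    from bspec[OF R this]
    have "\<omega> (d i * k + (d i * \<kappa> * m + v)) = a ! ((d i * \<kappa> * m + v) mod r)"
      by (simp only: fst_conv snd_conv)
    also have "(d i * \<kappa> * m + v) mod r = v mod r"
      using r_dvd[OF i] by (simp add: dvd_imp_mod_0 flip: mod_add_left_eq)
    also have "a ! (v mod r) = a ! v" using v by (rule is_period_mod[OF r_period])
    also have "d i * k + (d i * \<kappa> * m + v) = d i * (k + m * \<kappa>) + v" by (simp add: algebra_simps)
    finally show "\<omega> (d i * (k + m * \<kappa>) + v) = a ! v" .
  qed
qed

text \<open>The integers \<open>d i\<close> are distinct, so the blocks start at least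
  \<open>k\<close> apart, while their widths do not exceed \<open>k\<close>.\<close>

lemma inj_on_blocks:
  assumes "\<And>i. i \<in> {1..l} \<Longrightarrow> w i \<le> k"
  shows "inj_on (\<lambda>t. d (fst t) * k + snd t) (Sigma {1..l} (\<lambda>i. {..<w i}))"
proof -
  have less: "d i * k + u < d i' * k + u'" if "i \<in> {1..l}" "i' \<in> {1..l}" "u < w i" "i < i'" for i i' u u'
  proof -
    have "d i * k + u < (d i + 1) * k" using assms[of i] that by simp
    also have "\<dots> \<le> d i' * k" using d_less[of i i'] that by (intro mult_right_mono) auto
    finally show ?thesis by simp
  qed
  show ?thesis
  proof (rule inj_onI, clarsimp)
    fix i u i' u'
    assume *: "Suc 0 \<le> i" "i \<le> l" "Suc 0 \<le> i'" "i' \<le> l" "u < w i" "u' < w i'" "d i * k + u = d i' * k + u'"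
    have "i = i'" using less[of i i' u u'] less[of i' i u' u] * by (cases i i' rule: linorder_cases) auto
    thus "i = i' \<and> u = u'" using * by simp
  qed
qed

lemma run_width_le:
  assumes "i \<in> {1..l}" "j \<le> n"
  shows "n + d i * \<kappa> * j \<le> d l * n\<^sup>2"
proof -
  have "d i * \<kappa> * j \<le> d l * \<kappa> * n" using d_le assms by (intro mult_le_mono) auto
  also have "d l * \<kappa> * n = d l * n * \<kappa>" by simp
  finally show ?thesis using window_le by linarith
qed

text \<open>The probability of the fresh letters that one further step of a run requires in factor
  \<open>i\<close>.\<close>

definition gain :: "nat \<Rightarrow> real" where
  "gain i = (\<Prod>v<d i * \<kappa>. letter_prob (a ! ((n + v) mod r)))"

lemma prod_periodic:
  assumes i: "i \<in> {1..l}"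
  shows "(\<Prod>u<n + d i * \<kappa> * j. letter_prob (a ! (u mod r))) = p * gain i ^ j"
proof (induction j)
  case 0
  have "(\<Prod>u<n. letter_prob (a ! (u mod r))) = (\<Prod>u<n. letter_prob (a ! u))"
    by (intro prod.cong refl arg_cong[of _ _ letter_prob] is_period_mod[OF r_period]) auto
  thus ?case by (simp add: p_def prob_cylinder)
next
  case (Suc j)
  let ?D = "d i * \<kappa>" and ?f = "\<lambda>u. letter_prob (a ! (u mod r))"
  have "(\<Prod>u<n + ?D * Suc j. ?f u) = (\<Prod>u<n + ?D * j. ?f u) * (\<Prod>u\<in>{n + ?D * j..<n + ?D * j + ?D}. ?f u)"
    by (simp add: prod.atLeastLessThan_concat lessThan_atLeast0 algebra_simps)
  also have "(\<Prod>u\<in>{n + ?D * j..<n + ?D * j + ?D}. ?f u) = (\<Prod>v<?D. ?f (n + ?D * j + v))"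
    by (rule prod.reindex_bij_witness[of _ "\<lambda>v. n + ?D * j + v" "\<lambda>u. u - (n + ?D * j)"]) auto
  also have "\<dots> = gain i"
    unfolding gain_def
  proof (intro prod.cong refl)
    fix v
    \<comment> \<open>Moving by a multiple of \<open>r\<close> does not change the letters, so every
      step of the run costs the same factor.\<close>
    have "r dvd ?D * j" using r_dvd[OF i] by simp
    then obtain c where "?D * j = r * c" by (auto elim: dvdE)
    hence "n + ?D * j + v = (n + v) + r * c" by simp
    thus "?f (n + ?D * j + v) = letter_prob (a ! ((n + v) mod r))" by (simp only: mod_mult_self2)
  qed
  finally show ?case using Suc.IH by simp
qed

text \<open>From \<open>k = d l * n\<^sup>2\<close> on, blocks of different factors are disjoint,
  which makes the geometric law exact rather than approximate.\<close>

lemma prob_run_eq_gain: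
  assumes "d l * n\<^sup>2 \<le> k" "j \<le> n"
  shows "prob (run_event k j) = p ^ l * (\<Prod>i=1..l. gain i) ^ j"
proof -
  let ?T = "Sigma {1..l} (\<lambda>i. {..<n + d i * \<kappa> * j})"
  have "prob (run_event k j) = (\<Prod>t\<in>?T. letter_prob (a ! (snd t mod r)))"
    unfolding run_occurs_iff
  proof (rule prob_letters)
    show "inj_on (\<lambda>t. d (fst t) * k + snd t) ?T"
      using run_width_le[OF _ assms(2)] assms(1) by (intro inj_on_blocks) (meson le_trans)
  qed auto
  also have "\<dots> = (\<Prod>i\<in>{1..l}. \<Prod>u<n + d i * \<kappa> * j. letter_prob (a ! (u mod r)))"
    by (subst prod.Sigma) (auto simp: case_prod_unfold)
  also have "\<dots> = (\<Prod>i\<in>{1..l}. p * gain i ^ j)"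
    by (intro prod.cong refl prod_periodic)
  finally show ?thesis by (simp add: prod.distrib prod_power_distrib)
qed

text \<open>The prolonged periodic cylinder lies inside the cylinder of \<open>a\<close>, so
  conditioning is division by \<open>p\<close> and leaves the probability of the additional
  letters.\<close>

lemma \<rho>_eq: "\<rho> = (\<Prod>i=1..l. gain i)"
proof -
  have "prob {\<omega>. \<omega> \<in> periodic_cylinder (take r a) (n + d i * \<kappa>) \<and> \<omega> \<in> cylinder a} / p = gain i"
    if i: "i \<in> {1..l}" for i
  proof -
    have "r \<le> n" using n_bounds(1) d_pos[OF l_mem(1)] by (metis le_trans less_imp_le mult_le_mono1 mult_1)
    hence len: "length (take r a) = r" by simp
    have "(\<forall>u<n + d i * \<kappa>. \<omega> u = take r a ! (u mod r)) \<longleftrightarrow> (\<forall>u<n + d i * \<kappa>. \<omega> u = a ! (u mod r))" for \<omega>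
      using r_pos by simp
    moreover have "\<omega> \<in> cylinder a" if "\<forall>u<n + d i * \<kappa>. \<omega> u = a ! (u mod r)" for \<omega>
      using that is_period_mod[OF r_period] by (auto simp: cylinder_def)
    ultimately have "{\<omega>. \<omega> \<in> periodic_cylinder (take r a) (n + d i * \<kappa>) \<and> \<omega> \<in> cylinder a}
        = {\<omega>. \<forall>u\<in>{..<n + d i * \<kappa>}. \<omega> u = a ! (u mod r)}"
      using periodic_cylinder_iff[OF _ len, of _ "n + d i * \<kappa>"] r_pos by auto
    also have "prob \<dots> = p * gain i"
      using prob_letters[of "{..<n + d i * \<kappa>}" "\<lambda>u. u" "\<lambda>u. a ! (u mod r)"] prod_periodic[OF i, of 1] by simp
    finally show ?thesis using a_pos by (simp add: p_def)
  qed
  thus ?thesis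
    unfolding \<rho>_def rho_def Let_def r_def[symmetric] \<kappa>_def[symmetric] cond_prob_def
    by (intro prod.cong) (auto simp: p_def cylinder_def)
qed

lemma prob_run:
  assumes "d l * n\<^sup>2 \<le> k" "j \<le> n"
  shows "prob (run_event k j) = p ^ l * \<rho> ^ j"
  using prob_run_eq_gain[OF assms] by (simp add: \<rho>_eq)

lemma exp_decay_less_1: "exp (- \<Gamma>) < 1"
  using decay by (simp add: cylinder_decay_def)

lemma gain_bounds: "i \<in> {1..l} \<Longrightarrow> 0 \<le> gain i" "i \<in> {1..l} \<Longrightarrow> gain i \<le> exp (- \<Gamma>)"
proof -
  assume i: "i \<in> {1..l}"
  show "0 \<le> gain i" unfolding gain_def using letter_prob_nonneg by (intro prod_nonneg) auto
  have "gain i \<le> exp (- \<Gamma>) ^ (d i * \<kappa>)"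
    unfolding gain_def using prod_letter_prob_le[OF decay, of _ "{..<d i * \<kappa>}"] by simp
  also have "\<dots> \<le> exp (- \<Gamma>) ^ 1"
    using exp_decay_less_1 d\<kappa>_pos[OF i] by (intro power_decreasing) auto
  finally show "gain i \<le> exp (- \<Gamma>)" by simp
qed

lemma gain_le_1: "i \<in> {1..l} \<Longrightarrow> gain i \<le> 1"
  using gain_bounds(2)[of i] exp_decay_less_1 by linarith

lemma \<rho>_bounds: "0 \<le> \<rho>" "\<rho> \<le> exp (- \<Gamma>)" "\<rho> < 1"
proof -
  show "0 \<le> \<rho>" unfolding \<rho>_eq using gain_bounds by (intro prod_nonneg) auto
  have "\<rho> = gain 1 * (\<Prod>i\<in>{1..l} - {1}. gain i)"
    unfolding \<rho>_eq using l by (intro prod.remove) auto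
  also have "\<dots> \<le> exp (- \<Gamma>) * 1"
    using gain_bounds[OF l_mem(2)] gain_bounds gain_le_1
    by (intro mult_mono prod_le_1 prod_nonneg) (force intro: order.trans)+
  finally show "\<rho> \<le> exp (- \<Gamma>)" by simp
  thus "\<rho> < 1" using exp_decay_less_1 by linarith
qed

lemma run_event_measurable: "run_event k j \<in> events"
  unfolding run_occurs_iff by (rule letters_measurable) auto

lemma occurs_measurable: "{\<omega>. occurs \<omega> k} \<in> events"
  using run_event_measurable[of k 0] by simp

text \<open>The event is a run from \<open>k\<close> without the longer run that starts one step
  earlier, a difference of nested events. The margin \<open>\<kappa>\<close> in the hypothesis makes
  \<open>prob_run\<close> applicable at \<open>k - \<kappa>\<close> too.\<close>

lemma prob_clump_tail:
  assumes k: "d l * n\<^sup>2 + \<kappa> \<le> k" and j: "j < n"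
  shows "prob {\<omega> \<in> space P. j < clump (occurs \<omega>) \<kappa> n k} = p ^ l * (1 - \<rho>) * \<rho> ^ j"
proof -
  have "k - \<kappa> + \<kappa> = k" using k by linarith
  hence pred: "run (occurs \<omega>) \<kappa> (k - \<kappa>) (Suc j) \<longleftrightarrow> occurs \<omega> (k - \<kappa>) \<and> run (occurs \<omega>) \<kappa> k j" for \<omega>
    by (simp only: run_Suc)
  have eq: "{\<omega> \<in> space P. j < clump (occurs \<omega>) \<kappa> n k} = run_event k j - run_event (k - \<kappa>) (Suc j)"
    unfolding less_clump_iff[OF j] pred by auto
  have "run_event (k - \<kappa>) (Suc j) \<subseteq> run_event k j"
    by (simp add: pred Collect_mono)
  hence diff: "prob (run_event k j - run_event (k - \<kappa>) (Suc j)) = prob (run_event k j) - prob (run_event (k - \<kappa>) (Suc j))"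
    by (intro finite_measure_Diff run_event_measurable)
  have "prob (run_event k j) = p ^ l * \<rho> ^ j" "prob (run_event (k - \<kappa>) (Suc j)) = p ^ l * \<rho> ^ Suc j"
    using k j by (intro prob_run; linarith)+
  thus ?thesis unfolding eq diff by (simp only: power_Suc) (simp add: algebra_simps)
qed

section \<open>Two clumps at once\<close>

lemma clump_neq_0D: "clump (occurs \<omega>) \<kappa> n k \<noteq> 0 \<Longrightarrow> occurs \<omega> k \<and> \<not> occurs \<omega> (k - \<kappa>)"
  using less_clump_iff[of 0 n "occurs \<omega>" \<kappa> k] a_ne by simp

text \<open>Two occurrences at a small distance force that distance to be a multiple of \<open>\<kappa>\<close>, and then all
  the intermediate occurrences, so that they belong to one clump.\<close>

lemma occurs_between:
  assumes "occurs \<omega> i" "occurs \<omega> k" "i < k" "2 * (d l * (k - i)) < n"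
  shows "occurs \<omega> (k - \<kappa>)"
proof -
  define e where "e = k - i"
  have k: "k = i + e" using assms by (simp add: e_def)
  have e_le: "2 * (d j * e) \<le> n" if "j \<in> {1..l}" for j
    
    using mult_le_mono1[OF d_le[OF that], of e] assms(4) unfolding e_def[symmetric] by linarith
  have dvd: "r dvd d j * e" if j: "j \<in> {1..l}" for j
  proof (rule least_period_dvd[OF r_period r_pos _ r_least e_le[OF j]])
    show "is_period a (d j * e)"
      unfolding is_period_def
    proof (intro allI impI)
      fix u assume u: "u + d j * e < n"
      have "a ! (u + d j * e) = \<omega> (d j * i + (u + d j * e))"
        using assms(1) j u by (simp add: occurs_def)
      also have "d j * i + (u + d j * e) = d j * k + u" unfolding k by (simp add: algebra_simps)
      also have "\<omega> (d j * k + u) = a ! u" using assms(2) j u by (simp add: occurs_def)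
      finally show "a ! (u + d j * e) = a ! u" .
    qed
  qed
  hence "\<kappa> dvd e" using kappa_dvd_iff[of r l d e] r_pos by (simp add: \<kappa>_def)
  hence \<kappa>e: "\<kappa> \<le> e" using assms(3) by (intro dvd_imp_le) (auto simp: e_def)
  show ?thesis
    unfolding occurs_def
  proof (intro ballI allI impI)
    fix j s assume j: "j \<in> {1..l}" and s: "s < n"
    define D where "D = d j * \<kappa>"
    have D: "r dvd D" using r_dvd[OF j] by (simp add: D_def)
    have eD: "d j * e = d j * (e - \<kappa>) + D" 
      using add_mult_distrib2[of "d j" "e - \<kappa>" \<kappa>] \<kappa>e by (simp add: D_def)
    have pos: "d j * (k - \<kappa>) + s = d j * i + (d j * (e - \<kappa>) + s)"
    proof -
      have "k - \<kappa> = i + (e - \<kappa>)" using \<kappa>e k by simp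
      thus ?thesis by (simp only: add_mult_distrib2 add.assoc)
    qed
    show "\<omega> (d j * (k - \<kappa>) + s) = a ! s"
    \<comment> \<open>A letter of the word at \<open>k - \<kappa>\<close> is read off the word at
      \<open>i\<close> when that one reaches so far, otherwise off the word at \<open>k\<close>; the
      two together leave no gap since \<open>2 * (d j * e) \<le> n\<close>.\<close>
    proof (cases "d j * (e - \<kappa>) + s < n")
      case True
      have "r dvd d j * (e - \<kappa>)" using dvd[OF j] D unfolding eD by (simp add: dvd_add_left_iff)
      then obtain c where c: "d j * (e - \<kappa>) = r * c" by (auto elim: dvdE)
      have "d j * (k - \<kappa>) + s = d j * i + (s + r * c)" "s + r * c < n" using pos c True by linarith+
      hence "\<omega> (d j * (k - \<kappa>) + s) = a ! (s + r * c)"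
        using assms(1) j unfolding occurs_def by metis
      also have "\<dots> = a ! s" using True c by (intro is_period_mult[OF r_period]) simp
      finally show ?thesis .
    next
      case False
      have Ds: "D \<le> s" using False e_le[OF j] eD by linarith
      obtain c where c: "D = r * c" using D by (auto elim: dvdE)
      have "d j * k = d j * i + d j * e" by (simp add: k add_mult_distrib2)
      hence "d j * (k - \<kappa>) + s = d j * k + (s - D)" using pos Ds eD by linarith
      hence "\<omega> (d j * (k - \<kappa>) + s) = a ! (s - D)"
        using assms(2) j s by (simp add: occurs_def)
      also have "\<dots> = a ! (s - D + r * c)" using s Ds c by (intro is_period_mult[OF r_period, symmetric]) simp
      finally show ?thesis using Ds c by simp
    qed
  qed
qed

lemma exp_half_power: "(exp (- \<Gamma> * real n / 2))\<^sup>2 = exp (- \<Gamma>) ^ n"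
  by (simp add: power2_eq_square mult_exp_exp mult.commute flip: exp_of_nat_mult)

lemma p_bounds: "0 < p" "p \<le> exp (- \<Gamma>) ^ n" "p \<le> 1"
proof -
  show "0 < p" using a_pos by (simp add: p_def)
  show "p \<le> exp (- \<Gamma>) ^ n" unfolding p_def prob_cylinder
    using prod_letter_prob_le[OF decay, of "\<lambda>i. a ! i" "{..<n}"] by simp
  show "p \<le> 1" by (simp add: p_def)
qed

text \<open>All blocks at \<open>i\<close> are kept, and \<open>n \<le> i\<close> makes them
  disjoint. Of the occurrence at \<open>k\<close> only the end of the last block is kept, which lies
  to the right of everything read at \<open>i\<close>.\<close>

lemma prob_joint_occurs:
  assumes "n \<le> i" "i < k" "n \<le> 2 * (d l * (k - i))"
  shows "prob {\<omega>. occurs \<omega> i \<and> occurs \<omega> k} \<le> p ^ l * exp (- \<Gamma> * real n / 2)"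
proof -
  \<comment> \<open>Half of \<open>n\<close>, rounded up: the distance assumption frees at least so
    many final letters.\<close>
  define m where "m = (n + 1) div 2"
  have m: "m \<le> d l * (k - i)" "n \<le> 2 * m" "m \<le> n" using assms n_bounds(3) by (auto simp: m_def)
  let ?T1 = "Sigma {1..l} (\<lambda>_::nat. {..<n})" and ?T2 = "{n - m..<n}"
  let ?T = "?T1 <+> ?T2"
  define c where "c = (\<lambda>t. case t of Inl t \<Rightarrow> d (fst t) * i + snd t | Inr u \<Rightarrow> d l * k + u)"
  define y where "y = (\<lambda>t :: nat \<times> nat + nat. case t of Inl t \<Rightarrow> a ! snd t | Inr u \<Rightarrow> a ! u)"
  have less: "d j * i + u < d l * k + v" if "j \<in> {1..l}" "u < n" "n - m \<le> v" for j u v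
  proof -
    have "d j * i + u < d l * i + n" using mult_le_mono1[OF d_le[OF that(1)], of i] that(2) by linarith
    also have "\<dots> \<le> d l * i + d l * (k - i) + (n - m)" using m by linarith
    also have "\<dots> = d l * k + (n - m)" 
      using add_mult_distrib2[of "d l" i "k - i"] assms(2) by simp
    finally show ?thesis using that by linarith
  qed
  have "inj_on c ?T"
  proof (rule inj_onI)
    fix t t' assume t: "t \<in> ?T" "t' \<in> ?T" "c t = c t'"
    consider (ll) u u' where "t = Inl u" "t' = Inl u'" | (rr) u u' where "t = Inr u" "t' = Inr u'"
      | (lr) u u' where "t = Inl u" "t' = Inr u'" | (rl) u u' where "t = Inr u" "t' = Inl u'"
      by (cases t; cases t') auto
    thus "t = t'"
    proof cases
      case ll
      with t inj_onD[OF inj_on_blocks[of "\<lambda>_. n" i], of u u'] assms(1) show ?thesis by (auto simp: c_def)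
    next
      case lr
      with t less[of "fst u" "snd u" u'] show ?thesis by (auto simp: c_def)
    next
      case rl
      with t less[of "fst u'" "snd u'" u] show ?thesis by (auto simp: c_def)
    qed (use t in \<open>auto simp: c_def\<close>)
  qed
  hence eq: "prob {\<omega>. \<forall>t\<in>?T. \<omega> (c t) = y t} = (\<Prod>t\<in>?T. letter_prob (y t))"
    by (intro prob_letters) auto
  have "prob {\<omega>. occurs \<omega> i \<and> occurs \<omega> k} \<le> prob {\<omega>. \<forall>t\<in>?T. \<omega> (c t) = y t}"
    using l_mem by (intro finite_measure_mono letters_measurable) (auto simp: occurs_def c_def y_def)
  also have "\<dots> = (\<Prod>t\<in>?T1. letter_prob (a ! snd t)) * (\<Prod>u\<in>?T2. letter_prob (a ! u))"
    unfolding eq by (subst prod.Plus) (auto simp: y_def)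
  also have "(\<Prod>t\<in>?T1. letter_prob (a ! snd t)) = (\<Prod>j\<in>{1..l}. \<Prod>u<n. letter_prob (a ! u))"
    by (subst prod.Sigma) (auto simp: case_prod_unfold)
  also have "\<dots> = p ^ l" by (simp add: p_def prob_cylinder)
  also have "p ^ l * (\<Prod>u\<in>?T2. letter_prob (a ! u)) \<le> p ^ l * exp (- \<Gamma>) ^ m"
    using prod_letter_prob_le[OF decay, of "\<lambda>i. a ! i" ?T2] p_bounds m(3) by (intro mult_left_mono) auto
  also have "exp (- \<Gamma>) ^ m \<le> exp (- \<Gamma> * real n / 2)"
  proof -
    have "\<Gamma> * real n \<le> \<Gamma> * (2 * real m)"
      using m(2) decay by (intro mult_left_mono) (auto simp: cylinder_decay_def)
    thus ?thesis by (simp add: exp_of_nat_mult[symmetric] mult.commute)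
  qed
  finally show ?thesis using p_bounds by (simp add: mult_left_mono)
qed

text \<open>At a small distance the later occurrence has a predecessor at
  \<open>k - \<kappa>\<close>, so no clump starts there; at a large one
  \<open>prob_joint_occurs\<close> applies.\<close>

lemma prob_joint_clump:
  assumes "n \<le> i" "i < k"
  shows "prob {\<omega> \<in> space P. clump (occurs \<omega>) \<kappa> n k \<noteq> 0 \<and> clump (occurs \<omega>) \<kappa> n i \<noteq> 0}
    \<le> p ^ l * exp (- \<Gamma> * real n / 2)"
proof (cases "2 * (d l * (k - i)) < n")
  case True
  have "{\<omega> \<in> space P. clump (occurs \<omega>) \<kappa> n k \<noteq> 0 \<and> clump (occurs \<omega>) \<kappa> n i \<noteq> 0} = {}"
    using occurs_between[OF _ _ assms(2) True] clump_neq_0D by blast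
  thus ?thesis using p_bounds by (simp only: measure_empty) simp
next
  case False
  have "prob {\<omega> \<in> space P. clump (occurs \<omega>) \<kappa> n k \<noteq> 0 \<and> clump (occurs \<omega>) \<kappa> n i \<noteq> 0}
      \<le> prob {\<omega>. occurs \<omega> i \<and> occurs \<omega> k}"
  proof (rule finite_measure_mono)
    show "{\<omega> \<in> space P. clump (occurs \<omega>) \<kappa> n k \<noteq> 0 \<and> clump (occurs \<omega>) \<kappa> n i \<noteq> 0}
        \<subseteq> {\<omega>. occurs \<omega> i \<and> occurs \<omega> k}"
      using clump_neq_0D by blast
    show "{\<omega>. occurs \<omega> i \<and> occurs \<omega> k} \<in> events"
      using sets.Int[OF occurs_measurable[of i] occurs_measurable[of k]] by (simp add: Int_def)
  qed
  also have "\<dots> \<le> p ^ l * exp (- \<Gamma> * real n / 2)"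
    using False assms by (intro prob_joint_occurs) auto
  finally show ?thesis .
qed

section \<open>Coordinates read by a clump, and local independence\<close>

definition window :: "nat \<Rightarrow> nat set" where
  "window k = (\<Union>i\<in>{1..l}. {d i * (k - \<kappa>)..<d i * (k + (n - 1) * \<kappa>) + n})"

lemma finite_window: "finite (window k)"
  by (simp add: window_def)

text \<open>The clump at \<open>k\<close> inspects occurrences only from \<open>k - \<kappa>\<close>
  to \<open>k + (n - 1) * \<kappa>\<close>; a window contains the interval hull of their letters for
  each factor.\<close>

lemma clump_cong:
  assumes "\<And>c. c \<in> window k \<Longrightarrow> \<omega> c = \<omega>' c"
  shows "clump (occurs \<omega>) \<kappa> n k = clump (occurs \<omega>') \<kappa> n k"
proof -
  have occ: "occurs \<omega> k' = occurs \<omega>' k'" if k': "k - \<kappa> \<le> k'" "k' \<le> k + (n - 1) * \<kappa>" for k'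
  proof -
    have "\<omega> (d i * k' + j) = \<omega>' (d i * k' + j)" if ij: "i \<in> {1..l}" "j < n" for i j
    proof (rule assms)
      have "d i * (k - \<kappa>) \<le> d i * k'" "d i * k' \<le> d i * (k + (n - 1) * \<kappa>)"
        using k' by (auto intro!: mult_le_mono2)
      hence "d i * k' + j \<in> {d i * (k - \<kappa>)..<d i * (k + (n - 1) * \<kappa>) + n}"
        using ij(2) unfolding atLeastLessThan_iff by linarith
      thus "d i * k' + j \<in> window k" using ij unfolding window_def by blast
    qed
    thus ?thesis by (auto simp: occurs_def)
  qed
  have "run (occurs \<omega>) \<kappa> k j = run (occurs \<omega>') \<kappa> k j" if "j < n" for j
  proof -
    have "m * \<kappa> \<le> (n - 1) * \<kappa>" if "m \<le> j" for m
      using that \<open>j < n\<close> by (intro mult_le_mono1) auto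
    hence "occurs \<omega> (k + m * \<kappa>) = occurs \<omega>' (k + m * \<kappa>)" if "m \<le> j" for m
      using that by (intro occ) auto
    thus ?thesis by (simp add: run_def)
  qed
  hence "{j. j < n \<and> run (occurs \<omega>) \<kappa> k j} = {j. j < n \<and> run (occurs \<omega>') \<kappa> k j}" by blast
  moreover have "occurs \<omega> (k - \<kappa>) = occurs \<omega>' (k - \<kappa>)" by (rule occ) auto
  ultimately show ?thesis by (simp add: clump_def run_length_def)
qed

text \<open>Windows meet only if interval \<open>i\<close> of one meets interval \<open>j\<close> of
  the other. For each of the \<open>l\<^sup>2\<close> pairs this confines a strictly increasing
  function of the index to an interval of length at most \<open>2 * d l * n\<^sup>2\<close>.\<close>

lemma card_window_neighbours:
  "card {i. window (Suc (K + i)) \<inter> window k \<noteq> {}} \<le> 2 * l\<^sup>2 * d l * n\<^sup>2"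
    and finite_window_neighbours: "finite {i. window (Suc (K + i)) \<inter> window k \<noteq> {}}"
proof -
  \<comment> \<open>Obtained by solving the overlap inequalities for
    \<open>d j * Suc (K + s)\<close>. Truncation of \<open>lo\<close> at 0 is harmless for a lower
    bound on a natural number.\<close>
  define lo hi where "lo = (\<lambda>i j. d i * (k - \<kappa>) - d j * ((n - 1) * \<kappa>) - n)"
    and "hi = (\<lambda>i j. d i * (k + (n - 1) * \<kappa>) + n + d j * \<kappa>)"
  let ?V = "\<lambda>i j. {s. d j * Suc (K + s) \<in> {lo i j..<hi i j}}"
  let ?I = "{1..l} \<times> {1..l}"
  have sub: "{i. window (Suc (K + i)) \<inter> window k \<noteq> {}} \<subseteq> (\<Union>ij\<in>?I. ?V (fst ij) (snd ij))"
  proof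
    fix s assume "s \<in> {i. window (Suc (K + i)) \<inter> window k \<noteq> {}}"
    then obtain c where "c \<in> window (Suc (K + s))" "c \<in> window k" by blast
    then obtain i j where ij: "i \<in> {1..l}" "j \<in> {1..l}"
      and c: "d i * (k - \<kappa>) \<le> c" "c < d i * (k + (n - 1) * \<kappa>) + n"
        "d j * (Suc (K + s) - \<kappa>) \<le> c" "c < d j * (Suc (K + s) + (n - 1) * \<kappa>) + n"
      unfolding window_def UN_iff atLeastLessThan_iff by blast
    have "d j * Suc (K + s) \<le> d j * (Suc (K + s) - \<kappa>) + d j * \<kappa>"
      unfolding add_mult_distrib2[symmetric] by (intro mult_le_mono2) simp
    hence "d j * Suc (K + s) < hi i j" using c unfolding hi_def by linarith
    moreover have "lo i j \<le> d j * Suc (K + s)"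
      using c unfolding lo_def add_mult_distrib2 by linarith
    ultimately show "s \<in> (\<Union>ij\<in>?I. ?V (fst ij) (snd ij))" using ij by force
  qed
  have V: "finite (?V i j) \<and> card (?V i j) \<le> 2 * d l * n\<^sup>2" if ij: "i \<in> {1..l}" "j \<in> {1..l}" for i j
  proof -
    have inj: "inj_on (\<lambda>s. d j * Suc (K + s)) (?V i j)"
      using d_pos[OF ij(2)] by (auto simp: inj_on_def)
    have img: "(\<lambda>s. d j * Suc (K + s)) ` ?V i j \<subseteq> {lo i j..<hi i j}" by auto
    have "finite (?V i j)" using inj_on_finite[OF inj img] by simp
    moreover have "card (?V i j) \<le> hi i j - lo i j"
      using card_inj_on_le[OF inj img] by simp
    moreover have "hi i j - lo i j \<le> 2 * (d l * n * \<kappa> + n)"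
    proof -
      have split: "d * (n * \<kappa>) = d * ((n - 1) * \<kappa>) + d * \<kappa>" for d
        using n_bounds(3) by (cases n) (simp_all add: add_mult_distrib2)
      have "d i * k \<le> d i * (k - \<kappa>) + d i * \<kappa>"
        unfolding add_mult_distrib2[symmetric] by (intro mult_le_mono2) simp
      hence "hi i j - lo i j \<le> d i * (n * \<kappa>) + d j * (n * \<kappa>) + 2 * n"
        unfolding hi_def lo_def split add_mult_distrib2 by linarith
      also have "\<dots> \<le> d l * (n * \<kappa>) + d l * (n * \<kappa>) + 2 * n"
        using d_le ij by (intro add_mono mult_le_mono1) auto
      also have "\<dots> = 2 * (d l * n * \<kappa> + n)" by (simp add: algebra_simps)
      finally show ?thesis .
    qed
    moreover have "2 * (d l * n * \<kappa> + n) \<le> 2 * d l * n\<^sup>2"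
      using window_le unfolding mult.assoc[of 2] by (rule mult_le_mono2)
    ultimately show ?thesis by (meson order.trans)
  qed
  have fin: "finite (\<Union>ij\<in>?I. ?V (fst ij) (snd ij))" using V by auto
  show "finite {i. window (Suc (K + i)) \<inter> window k \<noteq> {}}" using finite_subset[OF sub fin] .
  have "card {i. window (Suc (K + i)) \<inter> window k \<noteq> {}} \<le> card (\<Union>ij\<in>?I. ?V (fst ij) (snd ij))"
    by (rule card_mono[OF fin sub])
  also have "\<dots> \<le> (\<Sum>ij\<in>?I. card (?V (fst ij) (snd ij)))" by (rule card_UN_le) simp
  also have "\<dots> \<le> (\<Sum>ij\<in>?I. 2 * d l * n\<^sup>2)" using V by (intro sum_mono) auto
  also have "\<dots> = 2 * l\<^sup>2 * d l * n\<^sup>2" by (simp add: power2_eq_square)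
  finally show "card {i. window (Suc (K + i)) \<inter> window k \<noteq> {}} \<le> 2 * l\<^sup>2 * d l * n\<^sup>2" .
qed

section \<open>Error terms and the final estimate\<close>

abbreviation "err \<equiv> exp (- \<Gamma> * real n / 2)"

lemma err_bounds: "0 < err" "err \<le> 1" "\<rho> ^ n \<le> err\<^sup>2" "p \<le> err\<^sup>2" "err\<^sup>2 \<le> err" "p ^ l \<le> p"
proof -
  show "err \<le> 1" using decay by (simp add: cylinder_decay_def)
  thus "err\<^sup>2 \<le> err" by (simp add: power2_eq_square mult_left_le)
  show "\<rho> ^ n \<le> err\<^sup>2" unfolding exp_half_power using \<rho>_bounds by (intro power_mono)
  show "p \<le> err\<^sup>2" unfolding exp_half_power by (rule p_bounds)
  show "p ^ l \<le> p" using p_bounds power_decreasing[OF l, of p] by simp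
qed simp

text \<open>The factor 2 leaves room for the predecessor: \<open>k - \<kappa>\<close> still exceeds
  \<open>d l * n\<^sup>2\<close> when \<open>k\<close> exceeds \<open>cutoff\<close>.\<close>

definition cutoff :: nat where
  "cutoff = 2 * (d l * n\<^sup>2)"

lemma cutoff_bounds: "d l * n\<^sup>2 + \<kappa> \<le> cutoff" "n \<le> cutoff" "\<kappa> \<le> cutoff"
proof -
  have "n \<le> d l * n\<^sup>2" using window_le by linarith
  thus "d l * n\<^sup>2 + \<kappa> \<le> cutoff" "n \<le> cutoff" "\<kappa> \<le> cutoff"
    using n_bounds by (auto simp: cutoff_def)
qed

text \<open>For small \<open>k\<close> the blocks may overlap, so only the first factor is used and
  the bound is \<open>p\<close> instead of \<open>p ^ l\<close>.\<close>

lemma prob_occurs_le: "prob {\<omega>. occurs \<omega> k} \<le> p"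
proof -
  have "prob {\<omega>. occurs \<omega> k} \<le> prob {\<omega>. \<forall>j\<in>{..<n}. \<omega> (d 1 * k + j) = a ! j}"
    using l_mem by (intro finite_measure_mono letters_measurable) (auto simp: occurs_def)
  also have "\<dots> = p"
    using prob_letters[of "{..<n}" "\<lambda>j. d 1 * k + j" "\<lambda>j. a ! j"] by (simp add: p_def prob_cylinder inj_on_def)
  finally show ?thesis .
qed

text \<open>Its complement supplies the hypotheses of \<open>sum_clump\<close>: no occurrence at the
  two ends of the range and no run of \<open>n + 1\<close> occurrences in between.\<close>

definition bad_event :: "nat \<Rightarrow> (nat \<Rightarrow> 'a) set" where
  "bad_event N = (\<Union>k\<in>{1..cutoff} \<union> {N - \<kappa><..N}. {\<omega>. occurs \<omega> k}) \<union> (\<Union>k\<in>{cutoff<..N}. run_event k n)"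

lemma bad_event_measurable: "bad_event N \<in> events"
  unfolding bad_event_def
  using occurs_measurable run_event_measurable by (intro sets.Un sets.finite_UN) auto

lemma prob_bad_event_le:
  "prob (bad_event N) \<le> (real cutoff + real \<kappa>) * p + real (N - cutoff) * (p ^ l * \<rho> ^ n)"
proof -
  let ?J = "{1..cutoff} \<union> {N - \<kappa><..N}"
  have "prob (\<Union>k\<in>?J. {\<omega>. occurs \<omega> k}) \<le> (\<Sum>k\<in>?J. prob {\<omega>. occurs \<omega> k})"
    using occurs_measurable by (intro finite_measure_subadditive_finite) auto
  also have "\<dots> \<le> real (card ?J) * p" using prob_occurs_le by (intro sum_bounded_above)
  also have "\<dots> \<le> (real cutoff + real \<kappa>) * p"
  proof (intro mult_right_mono)
    have "card ?J \<le> card {1..cutoff} + card {N - \<kappa><..N}" by (rule card_Un_le)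
    thus "real (card ?J) \<le> real cutoff + real \<kappa>" by simp
  qed (use p_bounds in simp)
  finally have 1: "prob (\<Union>k\<in>?J. {\<omega>. occurs \<omega> k}) \<le> (real cutoff + real \<kappa>) * p" .
  have "prob (\<Union>k\<in>{cutoff<..N}. run_event k n) \<le> (\<Sum>k\<in>{cutoff<..N}. prob (run_event k n))"
    using run_event_measurable by (intro finite_measure_subadditive_finite) auto
  also have "\<dots> = (\<Sum>k\<in>{cutoff<..N}. p ^ l * \<rho> ^ n)"
    using cutoff_bounds by (intro sum.cong refl prob_run) auto
  finally have 2: "prob (\<Union>k\<in>{cutoff<..N}. run_event k n) \<le> real (N - cutoff) * (p ^ l * \<rho> ^ n)"
    by simp
  have "prob (bad_event N) \<le> prob (\<Union>k\<in>?J. {\<omega>. occurs \<omega> k}) + prob (\<Union>k\<in>{cutoff<..N}. run_event k n)"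
    unfolding bad_event_def using occurs_measurable run_event_measurable
    by (intro measure_Un_le sets.finite_UN) auto
  with 1 2 show ?thesis by linarith
qed

abbreviation "\<xi> i \<omega> \<equiv> clump (occurs \<omega>) \<kappa> n (Suc (cutoff + i))"

lemma S_eq_sum_clump:
  assumes "\<omega> \<notin> bad_event N"
  shows "S l d (cylinder a) N \<omega> = (\<Sum>i<N - cutoff. \<xi> i \<omega>)"
proof -
  have early: "\<not> occurs \<omega> k" if "1 \<le> k" "k \<le> cutoff" for k
    using assms that by (auto simp: bad_event_def)
  have late: "\<not> occurs \<omega> k" if "N - \<kappa> < k" "k \<le> N" for k
    using assms that by (auto simp: bad_event_def)
  have runs: "\<not> run (occurs \<omega>) \<kappa> k n" if "cutoff < k" "k \<le> N" for k
    using assms that by (auto simp: bad_event_def)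
  have "S l d (cylinder a) N \<omega> = (\<Sum>k\<in>{cutoff<..N}. of_bool (occurs \<omega> k))"
    unfolding S_def X_eq
  proof (rule sum.mono_neutral_right)
    show "\<forall>k\<in>{1..N} - {cutoff<..N}. of_bool (occurs \<omega> k) = (0 :: nat)" using early by auto
  qed auto
  also have "\<dots> = (\<Sum>k\<in>{cutoff<..N}. clump (occurs \<omega>) \<kappa> n k)"
    using early late runs cutoff_bounds n_bounds by (intro sum_clump[symmetric]) auto
  also have "\<dots> = (\<Sum>i<N - cutoff. \<xi> i \<omega>)"
    by (rule sum.reindex_bij_witness[of _ "\<lambda>i. Suc (cutoff + i)" "\<lambda>k. k - Suc cutoff"]) auto
  finally show ?thesis .
qed

lemma indep_clump:
  "indep_var (count_space UNIV) (\<xi> k) (count_space UNIV)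
     (\<lambda>\<omega>. \<Sum>i\<in>{..<k} - {i. window (Suc (cutoff + i)) \<inter> window (Suc (cutoff + k)) \<noteq> {}}. \<xi> i \<omega>)"
proof -
  let ?J = "{..<k} - {i. window (Suc (cutoff + i)) \<inter> window (Suc (cutoff + k)) \<noteq> {}}"
  show ?thesis
  proof (rule indep_finite_range)
    show "finite (window (Suc (cutoff + k)))" "finite (\<Union>i\<in>?J. window (Suc (cutoff + i)))"
      using finite_window by auto
    show "window (Suc (cutoff + k)) \<inter> (\<Union>i\<in>?J. window (Suc (cutoff + i))) = {}" by blast
    show "\<xi> k \<omega> = \<xi> k \<omega>'" if "\<And>i. i \<in> window (Suc (cutoff + k)) \<Longrightarrow> \<omega> i = \<omega>' i" for \<omega> \<omega>'
      using that by (rule clump_cong)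
    show "(\<Sum>i\<in>?J. \<xi> i \<omega>) = (\<Sum>i\<in>?J. \<xi> i \<omega>')"
      if "\<And>i. i \<in> (\<Union>i\<in>?J. window (Suc (cutoff + i))) \<Longrightarrow> \<omega> i = \<omega>' i" for \<omega> \<omega>'
      using that by (intro sum.cong refl clump_cong) blast
  qed
qed

text \<open>Off the bad event the count equals the sum of the clumps, whose replacement costs the
  second term, with cap \<open>n\<close>, joint bound \<open>p ^ l * err\<close> and at most
  \<open>b\<close> neighbours.\<close>

lemma S_thinned_step:
  fixes L :: "nat set"
  defines "q \<equiv> p ^ l * (1 - \<rho>)" and "b \<equiv> 2 * (real l)\<^sup>2 * real (d l) * (real n)\<^sup>2"
  shows "\<bar>prob {\<omega>. S l d (cylinder a) N \<omega> \<in> L} - (thinned_step q \<rho> ^^ (N - cutoff)) (indicator L) 0\<bar>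
    \<le> prob (bad_event N) + real (N - cutoff) * (2 * b * (p ^ l * err) + 2 * b * q\<^sup>2 + q * \<rho> ^ n)"
proof -
  let ?M = "N - cutoff" and ?h = "indicator L :: nat \<Rightarrow> real"
  let ?Z = "\<lambda>\<omega>. \<Sum>i<?M. \<xi> i \<omega>"
  have "\<xi> k \<in> measurable P (count_space UNIV)" for k
    using indep_var_rv1[OF indep_clump] .
  hence Z: "?Z \<in> measurable P (count_space UNIV)" by (intro measurable_sum_nat) auto
  have [measurable]: "Measurable.pred P (\<lambda>\<omega>. occurs \<omega> k)" for k
    using occurs_measurable[of k] by (simp add: pred_def)
  have "(\<lambda>\<omega>. of_bool (occurs \<omega> k) :: nat) \<in> measurable P (count_space UNIV)" for k
    unfolding of_bool_def by measurable
  hence Sm: "S l d (cylinder a) N \<in> measurable P (count_space UNIV)"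
    unfolding S_def X_eq by (intro measurable_sum_nat) auto
  have hm: "(\<lambda>\<omega>. ?h (F \<omega>)) \<in> borel_measurable P" if "F \<in> measurable P (count_space UNIV)" for F
    using that by measurable
  have int: "integrable P (\<lambda>\<omega>. ?h (F \<omega>))" if "F \<in> measurable P (count_space UNIV)" for F
    using hm[OF that] by (intro integrable_const_bound[where B = 1]) (auto simp: indicator_def)
  have "{\<omega> \<in> space P. S l d (cylinder a) N \<omega> \<in> L} \<in> events" using Sm by measurable
  hence S_eq: "prob {\<omega>. S l d (cylinder a) N \<omega> \<in> L} = expectation (\<lambda>\<omega>. ?h (S l d (cylinder a) N \<omega>))"
    using Bochner_Integration.integral_cong[of P P "\<lambda>\<omega>. ?h (S l d (cylinder a) N \<omega>)"
      "indicator {\<omega>. S l d (cylinder a) N \<omega> \<in> L}"] by (simp add: indicator_def)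
  have "\<bar>expectation (\<lambda>\<omega>. ?h (S l d (cylinder a) N \<omega>)) - expectation (\<lambda>\<omega>. ?h (?Z \<omega>))\<bar>
      \<le> 1 * prob (bad_event N)"
    using S_eq_sum_clump by (intro abs_expectation_diff_le int Sm Z bad_event_measurable) (auto simp: indicator_def)
  moreover have "\<bar>expectation (\<lambda>\<omega>. ?h (?Z \<omega>)) - (thinned_step q \<rho> ^^ ?M) ?h 0\<bar>
      \<le> real ?M * (2 * b * (p ^ l * err) + 2 * b * q\<^sup>2 + q * \<rho> ^ n)"
  proof (rule local_dependence_thinned_step[where
        B = "\<lambda>k. {i. window (Suc (cutoff + i)) \<inter> window (Suc (cutoff + k)) \<noteq> {}}"])
    show "\<xi> k \<omega> \<le> n" for k \<omega> by (rule clump_le)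
    show "prob {\<omega> \<in> space P. j < \<xi> k \<omega>} = q * \<rho> ^ j" if "j < n" for k j
      unfolding q_def using cutoff_bounds that by (intro prob_clump_tail) auto
    show "prob {\<omega> \<in> space P. \<xi> k \<omega> \<noteq> 0 \<and> \<xi> i \<omega> \<noteq> 0} \<le> p ^ l * err" if "i < k" for i k
      using cutoff_bounds that by (intro prob_joint_clump) auto
    show "real (card ({..<k} \<inter> {i. window (Suc (cutoff + i)) \<inter> window (Suc (cutoff + k)) \<noteq> {}})) \<le> b" for k
    proof -
      have "card ({..<k} \<inter> {i. window (Suc (cutoff + i)) \<inter> window (Suc (cutoff + k)) \<noteq> {}})
          \<le> 2 * l\<^sup>2 * d l * n\<^sup>2"
        using card_mono[OF finite_window_neighbours Int_lower2] card_window_neighbours order.trans by blast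
      hence "real (card ({..<k} \<inter> {i. window (Suc (cutoff + i)) \<inter> window (Suc (cutoff + k)) \<noteq> {}}))
          \<le> real (2 * l\<^sup>2 * d l * n\<^sup>2)" by (simp only: of_nat_le_iff)
      thus ?thesis by (simp add: b_def)
    qed
    show "q \<le> 1" unfolding q_def using p_bounds \<rho>_bounds by (intro mult_le_one power_le_one) auto
    show "unit_fun ?h" by (auto simp: unit_fun_def indicator_def)
  qed (use n_bounds p_bounds \<rho>_bounds indep_clump in \<open>auto simp: q_def\<close>)
  ultimately show ?thesis unfolding S_eq by linarith
qed

text \<open>Every error is brought to a multiple of \<open>err\<close>: boundary terms through
  \<open>p \<le> err\<close>, and terms summed over all \<open>k\<close> through
  \<open>M * p ^ l \<le> t\<close> with one more small factor.\<close>

lemma S_compound_poisson: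
  fixes L :: "nat set"
  assumes t: "0 < t" and N: "N = nat \<lfloor>t / p ^ l\<rfloor>"
  shows "\<bar>prob {\<omega>. S l d (cylinder a) N \<omega> \<in> L}
      - poisson_mean (\<lambda>m. (geom_mean \<rho> ^^ m) (indicator L) 0) (t * (1 - \<rho>)) 0\<bar>
    \<le> 12 * (t + 1) * (real l)\<^sup>2 * real (d l) * (real n)\<^sup>2 * err"
proof -
  define q where "q = p ^ l * (1 - \<rho>)"
  define M where "M = real (N - cutoff)"
  define D where "D = real (d l) * (real n)\<^sup>2"
  define b where "b = 2 * (real l)\<^sup>2 * real (d l) * (real n)\<^sup>2"
  define Q where "Q = (real l)\<^sup>2 * D"
  have pl: "0 < p ^ l" "p ^ l \<le> err\<^sup>2" "p ^ l \<le> err" "p ^ l \<le> 1"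
    using p_bounds(1) err_bounds by (simp, linarith+)
  have "0 \<le> q" "q \<le> p ^ l"
    using pl \<rho>_bounds by (auto simp: q_def mult_left_le)
  hence q: "0 \<le> q" "q \<le> p ^ l" "q \<le> 1" "q \<le> err"
    using pl by linarith+
  have "real N = real_of_int \<lfloor>t / p ^ l\<rfloor>"
    using t pl unfolding N by simp
  hence fl: "t / p ^ l - 1 < real N" "real N \<le> t / p ^ l"
    by linarith+
  have M: "0 \<le> M" "M \<le> real N" "real N - real cutoff \<le> M" by (auto simp: M_def)
  \<comment> \<open>Rounding \<open>t / p ^ l\<close> to \<open>N\<close> loses at most one index,
    and dropping the early ones loses at most \<open>cutoff\<close>.\<close>
  have Mp: "M * p ^ l \<le> t" "t - M * p ^ l \<le> (real cutoff + 1) * p ^ l"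
  proof -
    have "M \<le> t / p ^ l" using M fl by linarith
    thus "M * p ^ l \<le> t" by (simp only: pos_le_divide_eq[OF pl(1)])
    have "t / p ^ l \<le> M + real cutoff + 1" using M fl by linarith
    hence "t \<le> (M + real cutoff + 1) * p ^ l" by (simp only: pos_divide_le_eq[OF pl(1)])
    thus "t - M * p ^ l \<le> (real cutoff + 1) * p ^ l" by (simp add: algebra_simps)
  qed
  have Mq: "0 \<le> M * q" "M * q \<le> t" using mult_left_mono[OF q(2) M(1)] Mp M(1) q(1) by auto
  have b: "0 \<le> b" by (simp add: b_def)
  have s1: "(real cutoff + real \<kappa>) * p \<le> (real cutoff + real n) * err"
    using n_bounds p_bounds err_bounds by (intro mult_mono) auto
  have s2: "M * (p ^ l * \<rho> ^ n) \<le> t * err"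
  proof -
    have "M * p ^ l * \<rho> ^ n \<le> t * err" using Mp err_bounds \<rho>_bounds M pl t by (intro mult_mono) auto
    thus ?thesis by (simp add: mult.assoc)
  qed
  have s3: "M * (2 * b * (p ^ l * err) + 2 * b * q\<^sup>2 + q * \<rho> ^ n) \<le> (4 * b + 1) * t * err"
  proof -
    have "2 * b * ((M * p ^ l) * err) \<le> 2 * b * (t * err)"
      using Mp err_bounds b by (intro mult_left_mono mult_right_mono) auto
    moreover have "2 * b * ((M * q) * q) \<le> 2 * b * (t * err)"
      using Mq q b t by (intro mult_left_mono mult_mono) auto
    moreover have "(M * q) * \<rho> ^ n \<le> t * err"
      using Mq err_bounds \<rho>_bounds t by (intro mult_mono) auto
    ultimately show ?thesis by (simp add: algebra_simps power2_eq_square)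
  qed
  have s4: "2 * M * q\<^sup>2 \<le> 2 * t * err"
  proof -
    have "(M * q) * q \<le> t * err" using Mq q t by (intro mult_mono) auto
    thus ?thesis by (simp add: power2_eq_square algebra_simps)
  qed
  have s5: "\<bar>M * q - t * (1 - \<rho>)\<bar> \<le> (real cutoff + 1) * err"
  proof -
    have "\<bar>M * q - t * (1 - \<rho>)\<bar> = (t - M * p ^ l) * (1 - \<rho>)"
    proof -
      have "M * q - t * (1 - \<rho>) = - ((t - M * p ^ l) * (1 - \<rho>))" by (simp add: q_def algebra_simps)
      thus ?thesis using Mp \<rho>_bounds by (simp add: abs_mult)
    qed
    also have "\<dots> \<le> t - M * p ^ l" using Mp \<rho>_bounds by (simp add: mult_left_le)
    also have "\<dots> \<le> (real cutoff + 1) * err"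
      using Mp(2) mult_left_mono[OF pl(3), of "real cutoff + 1"] by linarith
    finally show ?thesis .
  qed
  have u: "unit_fun (indicator L)" by (auto simp: unit_fun_def indicator_def)
  have "\<bar>(thinned_step q \<rho> ^^ (N - cutoff)) (indicator L) 0
      - poisson_mean (\<lambda>m. (geom_mean \<rho> ^^ m) (indicator L) 0) (t * (1 - \<rho>)) 0\<bar>
      \<le> 2 * M * q\<^sup>2 + \<bar>M * q - t * (1 - \<rho>)\<bar>"
    unfolding M_def using u \<rho>_bounds q t by (intro thinned_step_poisson) auto
  moreover have "\<bar>prob {\<omega>. S l d (cylinder a) N \<omega> \<in> L} - (thinned_step q \<rho> ^^ (N - cutoff)) (indicator L) 0\<bar>
      \<le> prob (bad_event N) + M * (2 * b * (p ^ l * err) + 2 * b * q\<^sup>2 + q * \<rho> ^ n)"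
    unfolding M_def q_def b_def by (rule S_thinned_step)
  moreover have "prob (bad_event N) \<le> (real cutoff + real \<kappa>) * p + M * (p ^ l * \<rho> ^ n)"
    unfolding M_def by (rule prob_bad_event_le)
  ultimately have "\<bar>prob {\<omega>. S l d (cylinder a) N \<omega> \<in> L}
      - poisson_mean (\<lambda>m. (geom_mean \<rho> ^^ m) (indicator L) 0) (t * (1 - \<rho>)) 0\<bar>
    \<le> (real cutoff + real n) * err + t * err + (4 * b + 1) * t * err + 2 * t * err + (real cutoff + 1) * err"
    using s1 s2 s3 s4 s5 by linarith
  also have "\<dots> = (2 * real cutoff + real n + 1 + 4 * t + 4 * b * t) * err"
    by (simp add: algebra_simps)
  also have "\<dots> \<le> (12 * (t + 1) * Q) * err"
  proof (intro mult_right_mono)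
    have "n \<le> d l * n\<^sup>2" using window_le by linarith
    hence "real n \<le> real (d l * n\<^sup>2)" by (simp only: of_nat_le_iff)
    hence nD: "real n \<le> D" by (simp add: D_def)
    have "1 \<le> (real l)\<^sup>2" using l by simp
    hence DQ: "D \<le> Q" unfolding Q_def using mult_right_mono[of 1 "(real l)\<^sup>2" D] by (simp add: D_def)
    have "1 \<le> Q" using nD DQ n_bounds(3) by linarith
    hence "t * 1 \<le> t * Q" using t by (intro mult_left_mono) auto
    moreover have "real cutoff = 2 * D" "b = 2 * Q" by (simp_all add: cutoff_def D_def b_def Q_def)
    \<comment> \<open>Termwise: \<open>2 * cutoff = 4 * D \<le> 4 * Q\<close>, then
      \<open>n \<le> Q\<close>, \<open>1 \<le> Q\<close>, \<open>4 * t \<le> 4 * (t * Q)\<close> and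
      \<open>4 * b * t = 8 * (t * Q)\<close>.\<close>
    ultimately have "2 * real cutoff + real n + 1 + 4 * t + 4 * b * t \<le> 4 * Q + Q + Q + 4 * (t * Q) + 8 * (t * Q)"
      using nD DQ \<open>1 \<le> Q\<close> by (simp add: mult.commute[of t])
    also have "\<dots> \<le> 12 * (t + 1) * Q" using \<open>1 \<le> Q\<close> by (simp add: algebra_simps)
    finally show "2 * real cutoff + real n + 1 + 4 * t + 4 * b * t \<le> 12 * (t + 1) * Q" .
  qed simp
  finally show ?thesis by (simp add: Q_def D_def mult.assoc)
qed

end

theorem theorem2p8:
  fixes P :: "(nat \<Rightarrow> 'a :: countable) measure"
  assumes "shift_probability P" and "product_stationary P"
  shows "(\<exists>\<Gamma>. cylinder_decay P \<Gamma>) \<and>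
    (\<forall>(\<Gamma>::real) (l::nat) (d::nat \<Rightarrow> nat) (a::'a list) (A::(nat \<Rightarrow> 'a) set) (n::nat) (t::real)
       (N::nat) (r::nat) (\<rho>::real) (M::'b measure) (W::'b \<Rightarrow> nat) (\<zeta>::nat \<Rightarrow> 'b \<Rightarrow> nat) (Y::'b \<Rightarrow> nat).
      cylinder_decay P \<Gamma> \<longrightarrow>
      1 \<le> l \<longrightarrow> 1 \<le> d 1 \<longrightarrow> strict_mono_on {1..l} d \<longrightarrow>
      n = length a \<longrightarrow> A = cylinder a \<longrightarrow> 0 < measure P A \<longrightarrow>
      0 < t \<longrightarrow> N = nat \<lfloor>t / measure P A ^ l\<rfloor> \<longrightarrow>
      r = return_time n A \<longrightarrow> \<rho> = rho P l d a \<longrightarrow> 1 \<le> n \<longrightarrow> n > r * (d l + 6) \<longrightarrow>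
      poisson_geometric M (t * (1 - \<rho>)) \<rho> W \<zeta> \<longrightarrow> Y = (\<lambda>x. \<Sum>k=1..W x. \<zeta> k x) \<longrightarrow>
      (SUP L::nat set. \<bar>\<P>(\<omega> in P. S l d A N \<omega> \<in> L) - \<P>(x in M. Y x \<in> L)\<bar>)
        \<le> 2 ^ (2 * l + 8) * (t + 1) * real l ^ 2 * real (d l) * real n ^ 4 * exp (- \<Gamma> * real n / 2)
          + 2 * wp (12 * real (d l) * real n ^ 2 * (t + 1) * exp (- \<Gamma> * real n / 2))
          + t ^ (n div r + 1) / fact (n div r + 1))"
proof -
  interpret iid_sequence P
    using assms by (simp add: iid_sequence_def iid_sequence_axioms_def)
  show ?thesis
  proof (intro conjI ex_cylinder_decay allI impI)
    fix \<Gamma> :: real and l :: nat and d :: "nat \<Rightarrow> nat" and a :: "'a list" and A :: "(nat \<Rightarrow> 'a) set"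
      and n :: nat and t :: real and N r :: nat and \<rho> :: real and M :: "'b measure"
      and W :: "'b \<Rightarrow> nat" and \<zeta> :: "nat \<Rightarrow> 'b \<Rightarrow> nat" and Y :: "'b \<Rightarrow> nat"
    assume *: "cylinder_decay P \<Gamma>" "1 \<le> l" "1 \<le> d 1" "strict_mono_on {1..l} d"
      "n = length a" "A = cylinder a" "0 < measure P A" "0 < t" "N = nat \<lfloor>t / measure P A ^ l\<rfloor>"
      "r = return_time n A" "\<rho> = rho P l d a" "1 \<le> n" "n > r * (d l + 6)"
      and pg: "poisson_geometric M (t * (1 - \<rho>)) \<rho> W \<zeta>" and Y: "Y = (\<lambda>x. \<Sum>k=1..W x. \<zeta> k x)"
    interpret pat: periodic_pattern P \<Gamma> l d a
      by unfold_locales (use * in auto)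
    let ?E = "exp (- \<Gamma> * real n / 2)"
    let ?B = "12 * (t + 1) * (real l)\<^sup>2 * real (d l) * (real n)\<^sup>2 * ?E"
    have "\<bar>\<P>(\<omega> in P. S l d A N \<omega> \<in> L) - \<P>(x in M. Y x \<in> L)\<bar> \<le> ?B" for L
    proof -
      have \<rho>: "\<rho> = pat.\<rho>" using * by (simp add: pat.\<rho>_def)
      have "\<P>(x in M. Y x \<in> L) = poisson_mean (\<lambda>m. (geom_mean \<rho> ^^ m) (indicator L) 0) (t * (1 - \<rho>)) 0"
        unfolding Y using pg pat.\<rho>_bounds * \<rho> by (intro poisson_geometric_prob) auto
      thus ?thesis
        using pat.S_compound_poisson[of t N L] * \<rho> by (simp add: pat.p_def)
    qed
    hence "(SUP L::nat set. \<bar>\<P>(\<omega> in P. S l d A N \<omega> \<in> L) - \<P>(x in M. Y x \<in> L)\<bar>) \<le> ?B"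
      by (intro cSUP_least) auto
    \<comment> \<open>The constant 12 is below \<open>2 ^ 8\<close>, and \<open>n\<^sup>2\<close> is
      below \<open>n ^ 4\<close> as \<open>n\<close> is positive.\<close>
    also have "?B \<le> 2 ^ (2 * l + 8) * (t + 1) * real l ^ 2 * real (d l) * real n ^ 4 * ?E"
    proof -
      have "12 \<le> (2::real) ^ (2 * l + 8)"
        using power_increasing[of 8 "2 * l + 8" "2::real"] by simp
      moreover have "(real n)\<^sup>2 \<le> real n ^ 4" using *(12) by (intro power_increasing) auto
      ultimately show ?thesis using *(8) by (intro mult_mono) auto
    qed
    \<comment> \<open>Both added terms are nonnegative because \<open>t\<close> is positive.\<close>
    also have "\<dots> \<le> \<dots> + 2 * wp (12 * real (d l) * real n ^ 2 * (t + 1) * ?E) + t ^ (n div r + 1) / fact (n div r + 1)"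
      using *(8) by (simp add: wp_def)
    finally show "(SUP L::nat set. \<bar>\<P>(\<omega> in P. S l d A N \<omega> \<in> L) - \<P>(x in M. Y x \<in> L)\<bar>)
        \<le> 2 ^ (2 * l + 8) * (t + 1) * real l ^ 2 * real (d l) * real n ^ 4 * ?E
          + 2 * wp (12 * real (d l) * real n ^ 2 * (t + 1) * ?E)
          + t ^ (n div r + 1) / fact (n div r + 1)" .
  qed
qed

end
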